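(* Let $\mathfrak{v}=\{\nu_i\}_{i\in I}$ be a totally ordered set in $\mathcal{V}$ such that every $f\in\mathbb{K}[x]$ is $\mathfrak{v}$-stable. Consider the direct system $\{(\mathcal{G}_{\nu_i},\phi_{ij})\}_{i\le j}^{i,j\in I}$ and let $\nu=\sup_{i\in I}\nu_i$ be the valuation on $\mathbb{K}[x]$ given by $\nu(f)=\nu_{i_f}(f)$, where $i_f\in I$ is any index with $\nu_i(f)=\nu_{i_f}(f)$ for all $i\ge i_f$. Then $\varinjlim\mathcal{G}_{\nu_i}\cong\mathcal{G}_\nu$ as commutative rings with unity.
   Context: A valuation on a commutative ring $A$ with unity is a map $\nu:A\to\Gamma_\infty=\Gamma\cup\{\infty\}$, with $\Gamma$ a totally ordered abelian group, such that $\nu(ab)=\nu(a)+\nu(b)$, $\nu(a+b)\ge\min\{\nu(a),\nu(b)\}$, $\nu(1)=0$, $\nu(0)=\infty$. Its support is $\mathrm{supp}(\nu)=\{a\mid\nu(a)=\infty\}$, which may be non-zero. Let $\mathbb{K}$ be a field, $\nu_0$ a valuation on $\mathbb{K}$ with support $\{0\}$ and value group $\Gamma_0$, and fix a totally ordered divisible abelian group $\Gamma\supseteq\Gamma_0$. Put $\mathcal{V}=\{\nu_0\}\cup\{\nu:\mathbb{K}[x]\to\Gamma_\infty\mid \nu\text{ is a valuation extending }\nu_0\}$, partially ordered by $\nu_0\le\nu$ for all $\nu\in\mathcal{V}$, and, for $\nu,\mu\in\mathcal{V}\setminus\{\nu_0\}$, $\nu\le\mu$ iff $\nu(f)\le\mu(f)$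 for all $f\in\mathbb{K}[x]$. The families $\mathfrak{v}=\{\nu_i\}_{i\in I}$ considered are non-empty and consist of valuations on $\mathbb{K}[x]$; $I$ carries the induced total order ($i\le j$ iff $\nu_i\le\nu_j$). A polynomial $f\in\mathbb{K}[x]$ is $\mathfrak{v}$-stable if there is $i_f\in I$ with $\nu_i(f)=\nu_{i_f}(f)$ for every $i\in I$ with $i\ge i_f$. Graded ring: for a valuation $\nu$ on $\mathbb{K}[x]$ and $\gamma\in\nu(\mathbb{K}[x]\setminus\mathrm{supp}(\nu))$ let $\mathcal{P}_\gamma=\{f\mid\nu(f)\ge\gamma\}$, $\mathcal{P}_\gamma^+=\{f\mid\nu(f)>\gamma\}$; then $\mathcal{G}_\nu=\bigoplus_\gamma\mathcal{P}_\gamma/\mathcal{P}_\gamma^+$, with product extending $(f+\mathcal{P}_\beta^+)(g+\mathcal{P}_\gamma^+)=fg+\mathcal{P}_{\beta+\gamma}^+$ for $\nu(f)=\beta$, $\nu(g)=\gamma$. For $f\notin\mathrm{supp}(\nu)$, $\mathrm{in}_\nu(f)$ is the image of $f$ in $\mathcal{P}_{\nu(f)}/\mathcal{P}_{\nu(f)}^+$; for $f\in\mathrm{supp}(\nu)$, $\mathrm{in}_\nu(f)=0$. For $i\le j$, $\phi_{ij}:\mathcal{G}_{\nu_i}\to\mathcal{G}_{\nu_j}$ is the (well-defined) ring homomorphism obtained by additive extension from $\mathrm{in}_{\nu_i}(f)\mapsto\mathrm{in}_{\nu_j}(f)$ if $\nu_i(f)=\nu_j(f)$ and $\mathrm{in}_{\nu_i}(f)\mapsto0$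 if $\nu_i(f)<\nu_j(f)$. These maps form a direct system over $I$. *)

theory Defs
  imports
    "HOL-Computational_Algebra.Polynomial"
    "HOL-Algebra.Product_Groups"
    "HOL-Algebra.QuotRing"
begin

section \<open>Value groups with infinity\<close>

datatype 'g infty = Fin 'g | Infty

instantiation infty :: (linordered_ab_group_add) linorder
begin

fun less_eq_infty :: "'a infty \<Rightarrow> 'a infty \<Rightarrow> bool" where
  "less_eq_infty x Infty = True"
| "less_eq_infty Infty (Fin b) = False"
| "less_eq_infty (Fin a) (Fin b) = (a \<le> b)"

definition less_infty :: "'a infty \<Rightarrow> 'a infty \<Rightarrow> bool" where
  "less_infty x y \<longleftrightarrow> x \<le> y \<and> \<not> y \<le> x"

instance
proof
  fix x y z :: "'a infty"
  show "x < y \<longleftrightarrow> x \<le> y \<and> \<not> y \<le> x" by (rule less_infty_def)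
  show "x \<le> x" by (cases x) auto
  show "x \<le> z" if "x \<le> y" "y \<le> z" using that by (cases x; cases y; cases z) auto
  show "x = y" if "x \<le> y" "y \<le> x" using that by (cases x; cases y) auto
  show "x \<le> y \<or> y \<le> x" by (cases x; cases y) auto
qed

end

instantiation infty :: (linordered_ab_group_add) ordered_comm_monoid_add
begin

fun plus_infty :: "'a infty \<Rightarrow> 'a infty \<Rightarrow> 'a infty" where
  "plus_infty x Infty = Infty"
| "plus_infty Infty (Fin b) = Infty"
| "plus_infty (Fin a) (Fin b) = Fin (a + b)"

definition zero_infty :: "'a infty" where
  "zero_infty = Fin 0"

instance
proof
  fix x y z :: "'a infty"
  show "x + y + z = x + (y + z)" by (cases x; cases y; cases z) (auto simp: add.assoc)
  show "x + y = y + x" by (cases x; cases y) (auto simp: add.commute)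
  show "0 + x = x" by (cases x) (auto simp: zero_infty_def)
  show "z + x \<le> z + y" if "x \<le> y" using that by (cases x; cases y; cases z) auto
qed

end

lemma Fin_less_iff [simp]: "Fin a < Fin b \<longleftrightarrow> a < b" "Fin a < Infty" "\<not> Infty < x"
  by (auto simp: less_infty_def)

lemma infty_le_Infty_iff [simp]: "Infty \<le> x \<longleftrightarrow> x = Infty"
  by (cases x) auto

lemma Infty_plus [simp]: "Infty + x = Infty"
  by (cases x) auto

definition divisible :: "'g::linordered_ab_group_add itself \<Rightarrow> bool" where
  "divisible _ \<longleftrightarrow> (\<forall>(g::'g) (n::nat). n > 0 \<longrightarrow> (\<exists>h. ((+) h ^^ n) 0 = g))"


section \<open>Valuations\<close>

definition valuation :: "('r::comm_ring_1 \<Rightarrow> 'g::linordered_ab_group_add infty) \<Rightarrow> bool" where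
  "valuation \<nu> \<longleftrightarrow>
     (\<forall>a b. \<nu> (a * b) = \<nu> a + \<nu> b) \<and>
     (\<forall>a b. \<nu> (a + b) \<ge> min (\<nu> a) (\<nu> b)) \<and>
     \<nu> 1 = 0 \<and> \<nu> 0 = Infty"

definition val_supp :: "('r \<Rightarrow> 'g infty) \<Rightarrow> 'r set" where
  "val_supp \<nu> = {a. \<nu> a = Infty}"

text \<open>The valuations on \<open>K[x]\<close> extending \<open>\<nu>\<^sub>0\<close>.  On these the partial order
  is the pointwise order of functions.  (The formal least element
  \<open>\<nu>\<^sub>0\<close>, which is not a valuation on \<open>K[x]\<close>, is left out.)\<close>

definition extensions :: "('k::field \<Rightarrow> 'g::linordered_ab_group_add infty) \<Rightarrow> ('k poly \<Rightarrow> 'g infty) set" where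
  "extensions \<nu>\<^sub>0 = {\<nu>. valuation \<nu> \<and> (\<forall>a. \<nu> [:a:] = \<nu>\<^sub>0 a)}"

text \<open>The index order induced by a family of valuations: \<open>i \<le> j\<close> iff \<open>\<nu>\<^sub>i \<le> \<nu>\<^sub>j\<close>.\<close>

definition index_rel :: "'i set \<Rightarrow> ('i \<Rightarrow> 'r \<Rightarrow> 'g::linordered_ab_group_add infty) \<Rightarrow> 'i rel" where
  "index_rel I \<nu> = {(i, j). i \<in> I \<and> j \<in> I \<and> \<nu> i \<le> \<nu> j}"

definition stable_index ::
  "'i set \<Rightarrow> ('i \<Rightarrow> 'r \<Rightarrow> 'g::linordered_ab_group_add infty) \<Rightarrow> 'r \<Rightarrow> 'i \<Rightarrow> bool" where
  "stable_index I \<nu> f i\<^sub>f \<longleftrightarrow> i\<^sub>f \<in> I \<and> (\<forall>i\<in>I. (i\<^sub>f, i) \<in> index_rel I \<nu> \<longrightarrow> \<nu> i f = \<nu> i\<^sub>f f)"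

definition fam_stable :: "'i set \<Rightarrow> ('i \<Rightarrow> 'r \<Rightarrow> 'g::linordered_ab_group_add infty) \<Rightarrow> 'r \<Rightarrow> bool" where
  "fam_stable I \<nu> f \<longleftrightarrow> (\<exists>i\<^sub>f. stable_index I \<nu> f i\<^sub>f)"

definition sup_val ::
  "'i set \<Rightarrow> ('i \<Rightarrow> 'r \<Rightarrow> 'g::linordered_ab_group_add infty) \<Rightarrow> 'r \<Rightarrow> 'g infty" where
  "sup_val I \<nu> f = \<nu> (SOME i\<^sub>f. stable_index I \<nu> f i\<^sub>f) f"


section \<open>The graded ring of a valuation\<close>

definition val_values :: "('r \<Rightarrow> 'g infty) \<Rightarrow> 'g set" where
  "val_values \<nu> = {\<gamma>. Fin \<gamma> \<in> \<nu> ` (UNIV - val_supp \<nu>)}"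

definition val_ge :: "('r \<Rightarrow> 'g::linordered_ab_group_add infty) \<Rightarrow> 'g \<Rightarrow> 'r set" where
  "val_ge \<nu> \<gamma> = {f. \<nu> f \<ge> Fin \<gamma>}"

definition val_gt :: "('r \<Rightarrow> 'g::linordered_ab_group_add infty) \<Rightarrow> 'g \<Rightarrow> 'r set" where
  "val_gt \<nu> \<gamma> = {f. \<nu> f > Fin \<gamma>}"

text \<open>The additive group of \<open>val_ge \<nu> \<gamma>\<close>, as a (multiplicatively written) group record.\<close>

definition val_ge_group :: "('r::comm_ring_1 \<Rightarrow> 'g::linordered_ab_group_add infty) \<Rightarrow> 'g \<Rightarrow> 'r monoid" where
  "val_ge_group \<nu> \<gamma> = \<lparr>carrier = val_ge \<nu> \<gamma>, mult = (+), one = 0\<rparr>"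

definition graded_piece :: "('r::comm_ring_1 \<Rightarrow> 'g::linordered_ab_group_add infty) \<Rightarrow> 'g \<Rightarrow> 'r set monoid" where
  "graded_piece \<nu> \<gamma> = val_ge_group \<nu> \<gamma> Mod val_gt \<nu> \<gamma>"

definition val_coset :: "('r::comm_ring_1 \<Rightarrow> 'g::linordered_ab_group_add infty) \<Rightarrow> 'g \<Rightarrow> 'r \<Rightarrow> 'r set" where
  "val_coset \<nu> \<gamma> f = val_gt \<nu> \<gamma> #>\<^bsub>val_ge_group \<nu> \<gamma>\<^esub> f"

text \<open>Elements of the graded ring are families \<open>(c\<^sub>\<gamma>)\<close> of cosets indexed by the values of \<open>\<nu>\<close>,
  almost all of them zero; \<open>initial_form \<nu> f\<close> has all entries zero if \<open>f\<close> is in the support.\<close>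

definition initial_form ::
  "('r::comm_ring_1 \<Rightarrow> 'g::linordered_ab_group_add infty) \<Rightarrow> 'r \<Rightarrow> 'g \<Rightarrow> 'r set" where
  "initial_form \<nu> f = (\<lambda>\<gamma>\<in>val_values \<nu>.
     if \<nu> f = Fin \<gamma> then val_coset \<nu> \<gamma> f else \<one>\<^bsub>graded_piece \<nu> \<gamma>\<^esub>)"

text \<open>The product of a coset at \<open>\<alpha>\<close> and a coset at \<open>\<beta>\<close>.  The union is over all representatives;
  it is the single coset of \<open>f * g\<close> for any choice of them (lemma \<open>coset_mult_coset\<close> below).\<close>

definition coset_mult ::
  "('r::comm_ring_1 \<Rightarrow> 'g::linordered_ab_group_add infty) \<Rightarrow> 'g \<Rightarrow> 'g \<Rightarrow> 'r set \<Rightarrow> 'r set \<Rightarrow> 'r set" where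
  "coset_mult \<nu> \<alpha> \<beta> C D = (\<Union>f\<in>C. \<Union>g\<in>D. val_coset \<nu> (\<alpha> + \<beta>) (f * g))"

definition graded_mult ::
  "('r::comm_ring_1 \<Rightarrow> 'g::linordered_ab_group_add infty) \<Rightarrow> ('g \<Rightarrow> 'r set) \<Rightarrow> ('g \<Rightarrow> 'r set) \<Rightarrow> 'g \<Rightarrow> 'r set" where
  "graded_mult \<nu> c d = (\<lambda>\<gamma>\<in>val_values \<nu>.
     finprod (graded_piece \<nu> \<gamma>)
       (\<lambda>(\<alpha>, \<beta>). coset_mult \<nu> \<alpha> \<beta> (c \<alpha>) (d \<beta>))
       {(\<alpha>, \<beta>). \<alpha> \<in> val_values \<nu> \<and> \<beta> \<in> val_values \<nu> \<and> \<alpha> + \<beta> = \<gamma> \<and>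
          c \<alpha> \<noteq> \<one>\<^bsub>graded_piece \<nu> \<alpha>\<^esub> \<and> d \<beta> \<noteq> \<one>\<^bsub>graded_piece \<nu> \<beta>\<^esub>})"

definition graded_ring ::
  "('r::comm_ring_1 \<Rightarrow> 'g::linordered_ab_group_add infty) \<Rightarrow> ('g \<Rightarrow> 'r set) ring" where
  "graded_ring \<nu> =
     \<lparr>carrier = carrier (sum_group (val_values \<nu>) (graded_piece \<nu>)),
      mult = graded_mult \<nu>,
      one = initial_form \<nu> 1,
      zero = \<one>\<^bsub>sum_group (val_values \<nu>) (graded_piece \<nu>)\<^esub>,
      add = (\<otimes>\<^bsub>sum_group (val_values \<nu>) (graded_piece \<nu>)\<^esub>)\<rparr>"

text \<open>The map of graded rings induced by \<open>\<mu> \<le> \<nu>\<close>: every \<open>c\<close> is the sum of its non-zero homogeneous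
  components \<open>c \<gamma>\<close>, and such a component is \<open>initial_form \<mu> f\<close> for every \<open>f \<in> c \<gamma>\<close>.
  The value does not depend on the choice of \<open>f\<close> (lemma \<open>graded_map_initial_form\<close> below).\<close>

definition graded_map ::
  "('r::comm_ring_1 \<Rightarrow> 'g::linordered_ab_group_add infty) \<Rightarrow> ('r \<Rightarrow> 'g infty) \<Rightarrow> ('g \<Rightarrow> 'r set) \<Rightarrow> 'g \<Rightarrow> 'r set" where
  "graded_map \<mu> \<nu> c =
     (\<Oplus>\<^bsub>graded_ring \<nu>\<^esub>\<gamma>\<in>{\<gamma>\<in>val_values \<mu>. c \<gamma> \<noteq> \<one>\<^bsub>graded_piece \<mu> \<gamma>\<^esub>}.
        let f = (SOME f. f \<in> c \<gamma>) in
        if \<mu> f = \<nu> f then initial_form \<nu> f else \<zero>\<^bsub>graded_ring \<nu>\<^esub>)"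


section \<open>Direct limits of rings\<close>

text \<open>The usual construction, for a system of rings \<open>R i\<close> and maps \<open>\<phi> i j\<close> (for \<open>(i, j) \<in> r\<close>) over
  an index set \<open>I\<close> directed by \<open>r\<close>: the disjoint union of the carriers modulo eventual equality.
  The unions over representatives in the operations are unions of equal classes.\<close>

definition dirlim_rel ::
  "'i set \<Rightarrow> 'i rel \<Rightarrow> ('i \<Rightarrow> ('a, 'm) ring_scheme) \<Rightarrow> ('i \<Rightarrow> 'i \<Rightarrow> 'a \<Rightarrow> 'a) \<Rightarrow> ('i \<times> 'a) rel" where
  "dirlim_rel I r R \<phi> = {((i, a), (j, b)).
     (i, a) \<in> (SIGMA i:I. carrier (R i)) \<and> (j, b) \<in> (SIGMA i:I. carrier (R i)) \<and>
     (\<exists>k\<in>I. (i, k) \<in> r \<and> (j, k) \<in> r \<and> \<phi> i k a = \<phi> j k b)}"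

definition dirlim_op ::
  "'i set \<Rightarrow> 'i rel \<Rightarrow> ('i \<Rightarrow> ('a, 'm) ring_scheme) \<Rightarrow> ('i \<Rightarrow> 'i \<Rightarrow> 'a \<Rightarrow> 'a) \<Rightarrow>
   ('i \<Rightarrow> 'a \<Rightarrow> 'a \<Rightarrow> 'a) \<Rightarrow> ('i \<times> 'a) set \<Rightarrow> ('i \<times> 'a) set \<Rightarrow> ('i \<times> 'a) set" where
  "dirlim_op I r R \<phi> oper X Y =
     (\<Union>(i, a)\<in>X. \<Union>(j, b)\<in>Y. \<Union>k\<in>{k\<in>I. (i, k) \<in> r \<and> (j, k) \<in> r}.
        dirlim_rel I r R \<phi> `` {(k, oper k (\<phi> i k a) (\<phi> j k b))})"

definition dirlim ::
  "'i set \<Rightarrow> 'i rel \<Rightarrow> ('i \<Rightarrow> ('a, 'm) ring_scheme) \<Rightarrow> ('i \<Rightarrow> 'i \<Rightarrow> 'a \<Rightarrow> 'a) \<Rightarrow> ('i \<times> 'a) set ring" where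
  "dirlim I r R \<phi> =
     \<lparr>carrier = (SIGMA i:I. carrier (R i)) // dirlim_rel I r R \<phi>,
      mult = dirlim_op I r R \<phi> (\<lambda>k. (\<otimes>\<^bsub>R k\<^esub>)),
      one = (\<Union>i\<in>I. dirlim_rel I r R \<phi> `` {(i, \<one>\<^bsub>R i\<^esub>)}),
      zero = (\<Union>i\<in>I. dirlim_rel I r R \<phi> `` {(i, \<zero>\<^bsub>R i\<^esub>)}),
      add = dirlim_op I r R \<phi> (\<lambda>k. (\<oplus>\<^bsub>R k\<^esub>))\<rparr>"


section \<open>Well-definedness\<close>

lemma
  assumes "valuation \<nu>"
  shows valuation_mult: "\<nu> (a * b) = \<nu> a + \<nu> b"
    and valuation_add: "\<nu> (a + b) \<ge> min (\<nu> a) (\<nu> b)"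
    and valuation_one: "\<nu> 1 = Fin 0"
    and valuation_zero: "\<nu> 0 = Infty"
  using assms by (auto simp: valuation_def zero_infty_def)

lemma valuation_minus:
  assumes "valuation \<nu>"
  shows "\<nu> (- a) = \<nu> a"
proof -
  have "\<nu> (-1) + \<nu> (-1) = Fin 0"
    using valuation_mult[OF assms, of "-1" "-1"] valuation_one[OF assms] by simp
  then obtain g where g: "\<nu> (-1) = Fin g" "g + g = 0"
    by (cases "\<nu> (-1)") auto
  then have "g = 0" by simp
  then have "\<nu> (-1) = 0" using g by (simp add: zero_infty_def)
  then show ?thesis
    using valuation_mult[OF assms, of "-1" a] by simp
qed

lemma val_ge_add: "valuation \<nu> \<Longrightarrow> f \<in> val_ge \<nu> \<gamma> \<Longrightarrow> g \<in> val_ge \<nu> \<gamma> \<Longrightarrow> f + g \<in> val_ge \<nu> \<gamma>"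
  unfolding val_ge_def using valuation_add[of \<nu> f g] by (auto simp: min_def split: if_splits)

lemma val_gt_add: "valuation \<nu> \<Longrightarrow> f \<in> val_gt \<nu> \<gamma> \<Longrightarrow> g \<in> val_gt \<nu> \<gamma> \<Longrightarrow> f + g \<in> val_gt \<nu> \<gamma>"
  unfolding val_gt_def using valuation_add[of \<nu> f g] by (auto simp: min_def split: if_splits)

lemma val_gt_subset: "val_gt \<nu> \<gamma> \<subseteq> val_ge \<nu> \<gamma>"
  by (auto simp: val_gt_def val_ge_def)

lemma comm_group_val_ge_group:
  assumes "valuation \<nu>"
  shows "comm_group (val_ge_group \<nu> \<gamma>)"
proof (rule comm_groupI)
  fix x assume "x \<in> carrier (val_ge_group \<nu> \<gamma>)"
  then show "\<exists>y\<in>carrier (val_ge_group \<nu> \<gamma>). y \<otimes>\<^bsub>val_ge_group \<nu> \<gamma>\<^esub> x = \<one>\<^bsub>val_ge_group \<nu> \<gamma>\<^esub>"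
    by (intro bexI[of _ "- x"]) (auto simp: val_ge_group_def val_ge_def valuation_minus[OF assms])
qed (auto simp: val_ge_group_def val_ge_add[OF assms] valuation_zero[OF assms] algebra_simps,
     auto simp: val_ge_def valuation_zero[OF assms])

lemma normal_val_gt:
  assumes "valuation \<nu>"
  shows "val_gt \<nu> \<gamma> \<lhd> val_ge_group \<nu> \<gamma>"
proof -
  interpret comm_group "val_ge_group \<nu> \<gamma>" by (rule comm_group_val_ge_group[OF assms])
  have "subgroup (val_gt \<nu> \<gamma>) (val_ge_group \<nu> \<gamma>)"
  proof (rule subgroupI)
    show "val_gt \<nu> \<gamma> \<noteq> {}"
      using valuation_zero[OF assms] by (auto simp: val_gt_def intro!: exI[of _ 0])
    fix a assume a: "a \<in> val_gt \<nu> \<gamma>"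
    have "inv\<^bsub>val_ge_group \<nu> \<gamma>\<^esub> a = - a"
      using a val_gt_subset[of \<nu> \<gamma>]
      by (intro inv_equality) (auto simp: val_ge_group_def val_ge_def valuation_minus[OF assms])
    then show "inv\<^bsub>val_ge_group \<nu> \<gamma>\<^esub> a \<in> val_gt \<nu> \<gamma>"
      using a by (simp add: val_gt_def valuation_minus[OF assms])
  qed (use val_gt_subset[of \<nu> \<gamma>] val_gt_add[OF assms] in \<open>auto simp: val_ge_group_def\<close>)
  then show ?thesis by (rule subgroup_imp_normal)
qed

lemma comm_group_graded_piece:
  assumes "valuation \<nu>"
  shows "comm_group (graded_piece \<nu> \<gamma>)"
proof -
  interpret comm_group "val_ge_group \<nu> \<gamma>" by (rule comm_group_val_ge_group[OF assms])
  show ?thesis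
    unfolding graded_piece_def
    by (rule abelian_FactGroup) (rule normal_imp_subgroup[OF normal_val_gt[OF assms]])
qed

lemma val_coset_altdef: "val_coset \<nu> \<gamma> f = {h + f | h. h \<in> val_gt \<nu> \<gamma>}"
  by (auto simp: val_coset_def r_coset_def val_ge_group_def)

lemma carrier_graded_piece: "carrier (graded_piece \<nu> \<gamma>) = val_coset \<nu> \<gamma> ` val_ge \<nu> \<gamma>"
  by (simp add: graded_piece_def carrier_FactGroup val_coset_def val_ge_group_def)

lemma one_graded_piece: "\<one>\<^bsub>graded_piece \<nu> \<gamma>\<^esub> = val_gt \<nu> \<gamma>"
  by (simp add: graded_piece_def)

lemma val_coset_eq_iff:
  assumes "valuation \<nu>"
  shows "val_coset \<nu> \<gamma> f = val_coset \<nu> \<gamma> g \<longleftrightarrow> f - g \<in> val_gt \<nu> \<gamma>"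
proof
  assume eq: "val_coset \<nu> \<gamma> f = val_coset \<nu> \<gamma> g"
  have "f \<in> val_coset \<nu> \<gamma> f"
    unfolding val_coset_altdef using valuation_zero[OF assms]
    by (auto simp: val_gt_def intro!: exI[of _ 0])
  then show "f - g \<in> val_gt \<nu> \<gamma>"
    unfolding eq by (auto simp: val_coset_altdef)
next
  assume d: "f - g \<in> val_gt \<nu> \<gamma>"
  then have d': "g - f \<in> val_gt \<nu> \<gamma>"
    using valuation_minus[OF assms, of "f - g"] by (simp add: val_gt_def)
  have "\<exists>h'. h + f = h' + g \<and> h' \<in> val_gt \<nu> \<gamma>" if "h \<in> val_gt \<nu> \<gamma>" for h
    using val_gt_add[OF assms that d] by (intro exI[of _ "h + (f - g)"]) simp
  moreover have "\<exists>h'. h + g = h' + f \<and> h' \<in> val_gt \<nu> \<gamma>" if "h \<in> val_gt \<nu> \<gamma>" for h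
    using val_gt_add[OF assms that d'] by (intro exI[of _ "h + (g - f)"]) simp
  ultimately show "val_coset \<nu> \<gamma> f = val_coset \<nu> \<gamma> g"
    unfolding val_coset_altdef by blast
qed

lemma mem_val_coset_iff: "f \<in> val_coset \<nu> \<gamma> g \<longleftrightarrow> f - g \<in> val_gt \<nu> \<gamma>"
  unfolding val_coset_altdef by (auto intro!: exI[of _ "f - g"])

lemma mult_mem_val_gt:
  assumes "valuation \<nu>" "f \<in> val_gt \<nu> \<alpha>" "g \<in> val_ge \<nu> \<beta>"
  shows "f * g \<in> val_gt \<nu> (\<alpha> + \<beta>)" "g * f \<in> val_gt \<nu> (\<alpha> + \<beta>)"
proof -
  show "f * g \<in> val_gt \<nu> (\<alpha> + \<beta>)"
    using assms(2,3) valuation_mult[OF assms(1), of f g]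
    by (cases "\<nu> f"; cases "\<nu> g") (auto simp: val_gt_def val_ge_def add_less_le_mono)
  then show "g * f \<in> val_gt \<nu> (\<alpha> + \<beta>)" by (simp add: mult.commute)
qed

lemma coset_mult_coset:
  assumes \<nu>: "valuation \<nu>" and f: "f \<in> val_ge \<nu> \<alpha>" and g: "g \<in> val_ge \<nu> \<beta>"
  shows "coset_mult \<nu> \<alpha> \<beta> (val_coset \<nu> \<alpha> f) (val_coset \<nu> \<beta> g) = val_coset \<nu> (\<alpha> + \<beta>) (f * g)"
proof -
  have z: "0 \<in> val_gt \<nu> \<gamma>" for \<gamma>
    using valuation_zero[OF \<nu>] by (simp add: val_gt_def)
  have "val_coset \<nu> (\<alpha> + \<beta>) (f' * g') = val_coset \<nu> (\<alpha> + \<beta>) (f * g)"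
    if f': "f' \<in> val_coset \<nu> \<alpha> f" and g': "g' \<in> val_coset \<nu> \<beta> g" for f' g'
  proof -
    have "f' - f \<in> val_gt \<nu> \<alpha>" "g' - g \<in> val_gt \<nu> \<beta>"
      using f' g' by (simp_all add: mem_val_coset_iff)
    moreover have "g' \<in> val_ge \<nu> \<beta>"
      using val_ge_add[OF \<nu> _ g, of "g' - g"] \<open>g' - g \<in> _\<close> val_gt_subset[of \<nu> \<beta>] by auto
    ultimately have "(f' - f) * g' + f * (g' - g) \<in> val_gt \<nu> (\<alpha> + \<beta>)"
      using mult_mem_val_gt[OF \<nu>] f val_gt_add[OF \<nu>] by (metis add.commute)
    then show ?thesis
      by (simp add: val_coset_eq_iff[OF \<nu>] algebra_simps)
  qed
  moreover have "f \<in> val_coset \<nu> \<alpha> f" "g \<in> val_coset \<nu> \<beta> g"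
    by (simp_all add: mem_val_coset_iff z)
  ultimately show ?thesis
    unfolding coset_mult_def by blast
qed

lemma comm_group_graded_sum:
  assumes "valuation \<nu>"
  shows "comm_group (sum_group (val_values \<nu>) (graded_piece \<nu>))"
proof (rule group.group_comm_groupI)
  have cg: "comm_group (graded_piece \<nu> \<gamma>)" for \<gamma>
    by (rule comm_group_graded_piece[OF assms])
  then have grp: "group (graded_piece \<nu> \<gamma>)" for \<gamma>
    by (rule comm_group.axioms(2))
  show "group (sum_group (val_values \<nu>) (graded_piece \<nu>))"
    by (rule sum_group) (rule grp)
  fix x y
  assume "x \<in> carrier (sum_group (val_values \<nu>) (graded_piece \<nu>))"
    "y \<in> carrier (sum_group (val_values \<nu>) (graded_piece \<nu>))"
  then have "x \<gamma> \<otimes>\<^bsub>graded_piece \<nu> \<gamma>\<^esub> y \<gamma> = y \<gamma> \<otimes>\<^bsub>graded_piece \<nu> \<gamma>\<^esub> x \<gamma>"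
    if "\<gamma> \<in> val_values \<nu>" for \<gamma>
    using that by (intro comm_monoid.m_comm comm_group.axioms(1)[OF cg])
      (auto simp: carrier_sum_group grp)
  then show "x \<otimes>\<^bsub>sum_group (val_values \<nu>) (graded_piece \<nu>)\<^esub> y =
      y \<otimes>\<^bsub>sum_group (val_values \<nu>) (graded_piece \<nu>)\<^esub> x"
    by (auto simp: fun_eq_iff)
qed

lemma add_monoid_graded_ring:
  "add_monoid (graded_ring \<nu>) = sum_group (val_values \<nu>) (graded_piece \<nu>)"
  by (rule monoid.equality) (simp_all add: graded_ring_def)

lemma initial_form_in_carrier:
  assumes "valuation \<nu>"
  shows "initial_form \<nu> f \<in> carrier (graded_ring \<nu>)"
proof -
  have grp: "group (graded_piece \<nu> \<gamma>)" for \<gamma>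
    using comm_group_graded_piece[OF assms] by (simp add: comm_group_def)
  have fin: "finite {\<gamma> \<in> val_values \<nu>. initial_form \<nu> f \<gamma> \<noteq> \<one>\<^bsub>graded_piece \<nu> \<gamma>\<^esub>}"
    by (rule finite_subset[of _ "{\<gamma>. \<nu> f = Fin \<gamma>}"], force simp: initial_form_def)
       (cases "\<nu> f", auto)
  have "initial_form \<nu> f \<gamma> \<in> carrier (graded_piece \<nu> \<gamma>)" if "\<gamma> \<in> val_values \<nu>" for \<gamma>
    using that monoid.one_closed[OF group.is_monoid[OF grp]]
    by (auto simp: initial_form_def carrier_graded_piece val_ge_def)
  then show ?thesis
    using fin by (auto simp: graded_ring_def carrier_sum_group grp initial_form_def)
qed

lemma (in comm_monoid) finprod_single: "f a \<in> carrier G \<Longrightarrow> finprod G f {a} = f a"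
  by simp

lemma graded_map_initial_form:
  assumes \<mu>: "valuation \<mu>" and \<nu>: "valuation \<nu>" and le: "\<mu> \<le> \<nu>"
  shows "graded_map \<mu> \<nu> (initial_form \<mu> f) =
    (if \<mu> f = \<nu> f then initial_form \<nu> f else \<zero>\<^bsub>graded_ring \<nu>\<^esub>)"
proof -
  interpret A: comm_group "add_monoid (graded_ring \<nu>)"
    unfolding add_monoid_graded_ring by (rule comm_group_graded_sum[OF \<nu>])
  have z: "0 \<in> val_gt \<nu> \<gamma>" "0 \<in> val_gt \<mu> \<gamma>" for \<gamma>
    using valuation_zero[OF \<nu>] valuation_zero[OF \<mu>] by (simp_all add: val_gt_def)
  show ?thesis
  proof (cases "\<mu> f")
    case Infty
    then have "\<nu> f = Infty" using le by (metis infty_le_Infty_iff le_funE)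
    moreover have "{\<gamma> \<in> val_values \<mu>. initial_form \<mu> f \<gamma> \<noteq> \<one>\<^bsub>graded_piece \<mu> \<gamma>\<^esub>} = {}"
      using Infty by (auto simp: initial_form_def)
    moreover have "initial_form \<nu> f = \<zero>\<^bsub>graded_ring \<nu>\<^esub>"
      using \<open>\<nu> f = Infty\<close> by (auto simp: initial_form_def graded_ring_def)
    ultimately show ?thesis
      unfolding graded_map_def finsum_def by (simp only: A.finprod_empty) simp
  next
    case (Fin \<gamma>)
    have v: "\<gamma> \<in> val_values \<mu>"
      using Fin unfolding val_values_def val_supp_def by (auto intro!: image_eqI[of _ _ f])
    have "f \<in> val_coset \<mu> \<gamma> f" "f \<notin> val_gt \<mu> \<gamma>"
      using Fin by (simp_all add: mem_val_coset_iff z, simp add: val_gt_def)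
    then have S: "{\<delta> \<in> val_values \<mu>. initial_form \<mu> f \<delta> \<noteq> \<one>\<^bsub>graded_piece \<mu> \<delta>\<^esub>} = {\<gamma>}"
      using Fin v by (auto simp: initial_form_def one_graded_piece)
    define f' where "f' = (SOME g. g \<in> initial_form \<mu> f \<gamma>)"
    have I: "initial_form \<mu> f \<gamma> = val_coset \<mu> \<gamma> f"
      using Fin v by (simp add: initial_form_def)
    have "f' \<in> val_coset \<mu> \<gamma> f"
      unfolding f'_def I by (rule someI[of _ f]) fact
    then have d: "f' - f \<in> val_gt \<mu> \<gamma>" by (simp add: mem_val_coset_iff)
    then have d\<nu>: "f' - f \<in> val_gt \<nu> \<gamma>"
      using le by (auto simp: val_gt_def le_fun_def intro: less_le_trans)
    have ff: "\<nu> f' = Fin \<gamma> \<longleftrightarrow> \<nu> f = Fin \<gamma>" if "valuation \<nu>" "f' - f \<in> val_gt \<nu> \<gamma>" for \<nu> :: "'a \<Rightarrow> 'b infty"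
    proof -
      have 1: "\<nu> (f - f') > Fin \<gamma>" "\<nu> (f' - f) > Fin \<gamma>"
        using that valuation_minus[OF that(1), of "f' - f"] by (simp_all add: val_gt_def)
      have 2: "min (\<nu> f) (\<nu> (f' - f)) \<le> \<nu> f'" "min (\<nu> f') (\<nu> (f - f')) \<le> \<nu> f"
        using valuation_add[OF that(1), of f "f' - f"] valuation_add[OF that(1), of f' "f - f'"]
        by simp_all
      show ?thesis
        using 1 2 by (auto simp: min_def split: if_splits)
    qed
    have "\<mu> f' = Fin \<gamma>" using ff[OF \<mu> d] Fin by simp
    then have 1: "\<mu> f' = \<nu> f' \<longleftrightarrow> \<mu> f = \<nu> f" using ff[OF \<nu> d\<nu>] Fin by metis
    have 2: "initial_form \<nu> f' = initial_form \<nu> f" if "\<mu> f = \<nu> f"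
    proof -
      have "val_coset \<nu> \<gamma> f' = val_coset \<nu> \<gamma> f"
        using d\<nu> by (simp add: val_coset_eq_iff[OF \<nu>])
      moreover have "\<nu> f = Fin \<gamma>" "\<nu> f' = Fin \<gamma>"
        using that Fin ff[OF \<nu> d\<nu>] by simp_all
      ultimately show ?thesis
        by (simp add: initial_form_def restrict_def fun_eq_iff)
    qed
    let ?t = "if \<mu> f' = \<nu> f' then initial_form \<nu> f' else \<zero>\<^bsub>graded_ring \<nu>\<^esub>"
    have cl: "initial_form \<nu> f' \<in> carrier (graded_ring \<nu>)" "\<zero>\<^bsub>graded_ring \<nu>\<^esub> \<in> carrier (graded_ring \<nu>)"
      using initial_form_in_carrier[OF \<nu>] A.one_closed by auto
    have "graded_map \<mu> \<nu> (initial_form \<mu> f) = ?t"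
      unfolding graded_map_def S finsum_def Let_def
      using cl by (subst A.finprod_single) (simp_all only: f'_def partial_object.simps split: if_split, simp)
    then show ?thesis using 1 2 by auto
  qed
qed

lemma index_rel_total:
  assumes "linear_order_on I (index_rel I \<nu>)" "i \<in> I" "j \<in> I"
  shows "(i, j) \<in> index_rel I \<nu> \<or> (j, i) \<in> index_rel I \<nu>"
  using assms(1) unfolding linear_order_on_def total_on_def
  using assms(2,3) by (cases "i = j") (auto simp: index_rel_def)

lemma stable_index_in: "stable_index I \<nu> f i \<Longrightarrow> i \<in> I"
  unfolding stable_index_def by blast

lemma stable_indexD:
  assumes "stable_index I \<nu> f i" "(i, j) \<in> index_rel I \<nu>"
  shows "\<nu> j f = \<nu> i f"
  using assms unfolding stable_index_def index_rel_def by blast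

lemma stable_index_mono:
  assumes "stable_index I \<nu> f i" "(i, j) \<in> index_rel I \<nu>"
  shows "stable_index I \<nu> f j"
  unfolding stable_index_def
proof (intro conjI ballI impI)
  show "j \<in> I" using assms(2) by (simp add: index_rel_def)
  fix k assume "(j, k) \<in> index_rel I \<nu>"
  then have "(i, k) \<in> index_rel I \<nu>"
    using assms(2) by (auto simp: index_rel_def)
  then show "\<nu> k f = \<nu> j f"
    using stable_indexD[OF assms(1)] assms(2) by metis
qed

lemma sup_val_eq:
  assumes lin: "linear_order_on I (index_rel I \<nu>)" and i: "stable_index I \<nu> f i"
  shows "sup_val I \<nu> f = \<nu> i f"
proof -
  define j where "j = (SOME i. stable_index I \<nu> f i)"
  have j: "stable_index I \<nu> f j"
    unfolding j_def using i by (rule someI)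
  have "(i, j) \<in> index_rel I \<nu> \<or> (j, i) \<in> index_rel I \<nu>"
    by (rule index_rel_total[OF lin stable_index_in[OF i] stable_index_in[OF j]])
  then have "\<nu> j f = \<nu> i f"
  proof
    assume "(i, j) \<in> index_rel I \<nu>"
    then show ?thesis by (rule stable_indexD[OF i])
  next
    assume "(j, i) \<in> index_rel I \<nu>"
    then show ?thesis by (rule stable_indexD[OF j, symmetric])
  qed
  then show ?thesis
    by (simp add: sup_val_def j_def)
qed

lemma common_stable_index:
  assumes lin: "linear_order_on I (index_rel I \<nu>)" and ne: "I \<noteq> {}"
    and st: "\<forall>f. fam_stable I \<nu> f" and fin: "finite F"
  shows "\<exists>i\<in>I. \<forall>f\<in>F. stable_index I \<nu> f i"
  using fin
proof induction
  case empty
  then show ?case using ne by auto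
next
  case (insert f F)
  then obtain i where i: "i \<in> I" "\<forall>f\<in>F. stable_index I \<nu> f i" by auto
  obtain j where j: "stable_index I \<nu> f j" using st by (auto simp: fam_stable_def)
  have "(i, j) \<in> index_rel I \<nu> \<or> (j, i) \<in> index_rel I \<nu>"
    by (rule index_rel_total[OF lin i(1) stable_index_in[OF j]])
  then show ?case
  proof
    assume ij: "(i, j) \<in> index_rel I \<nu>"
    then have "j \<in> I" by (simp add: index_rel_def)
    moreover have "\<forall>g\<in>insert f F. stable_index I \<nu> g j"
      using i(2) j stable_index_mono[OF _ ij] by blast
    ultimately show ?case by blast
  next
    assume ji: "(j, i) \<in> index_rel I \<nu>"
    have "\<forall>g\<in>insert f F. stable_index I \<nu> g i"
      using i(2) stable_index_mono[OF j ji] by blast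
    then show ?case using i(1) by blast
  qed
qed

lemma sup_val_in_extensions:
  assumes lin: "linear_order_on I (index_rel I \<nu>)" and ne: "I \<noteq> {}"
    and st: "\<forall>f. fam_stable I \<nu> f" and ext: "\<forall>i\<in>I. \<nu> i \<in> extensions \<nu>\<^sub>0"
  shows "sup_val I \<nu> \<in> extensions \<nu>\<^sub>0"
proof -
  have loc: "\<exists>i. valuation (\<nu> i) \<and> (\<forall>a. \<nu> i [:a:] = \<nu>\<^sub>0 a) \<and> (\<forall>f\<in>F. sup_val I \<nu> f = \<nu> i f)"
    if F: "finite F" for F
  proof -
    obtain i where i: "i \<in> I" "\<forall>f\<in>F. stable_index I \<nu> f i"
      using common_stable_index[OF lin ne st F] by blast
    then have "\<forall>f\<in>F. sup_val I \<nu> f = \<nu> i f"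
      using sup_val_eq[OF lin] by blast
    then show ?thesis
      using i(1) ext by (auto simp: extensions_def)
  qed
  show ?thesis
    unfolding extensions_def valuation_def
  proof (intro CollectI conjI allI)
    fix a b
    show "sup_val I \<nu> (a * b) = sup_val I \<nu> a + sup_val I \<nu> b"
      using loc[of "{a, b, a * b}"] by (auto simp: valuation_def)
    show "sup_val I \<nu> (a + b) \<ge> min (sup_val I \<nu> a) (sup_val I \<nu> b)"
      using loc[of "{a, b, a + b}"] by (auto simp: valuation_def)
  next
    show "sup_val I \<nu> 1 = 0" using loc[of "{1}"] by (auto simp: valuation_def)
    show "sup_val I \<nu> 0 = Infty" using loc[of "{0}"] by (auto simp: valuation_def)
    show "sup_val I \<nu> [:a:] = \<nu>\<^sub>0 a" for a using loc[of "{[:a:]}"] by auto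
  qed
qed

lemma sup_val_least_upper_bound:
  assumes lin: "linear_order_on I (index_rel I \<nu>)" and st: "\<forall>f. fam_stable I \<nu> f"
  shows "i \<in> I \<Longrightarrow> \<nu> i \<le> sup_val I \<nu>"
    and "(\<And>i. i \<in> I \<Longrightarrow> \<nu> i \<le> \<mu>) \<Longrightarrow> sup_val I \<nu> \<le> \<mu>"
proof -
  show "sup_val I \<nu> \<le> \<mu>" if "\<And>i. i \<in> I \<Longrightarrow> \<nu> i \<le> \<mu>"
  proof (rule le_funI)
    fix f
    obtain j where j: "stable_index I \<nu> f j" using st by (auto simp: fam_stable_def)
    then have "j \<in> I" by (rule stable_index_in)
    then show "sup_val I \<nu> f \<le> \<mu> f"
      using that sup_val_eq[OF lin j] by (simp add: le_fun_def)
  qed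
  show "\<nu> i \<le> sup_val I \<nu>" if i: "i \<in> I"
  proof (rule le_funI)
    fix f
    obtain j where j: "stable_index I \<nu> f j" using st by (auto simp: fam_stable_def)
    have "(i, j) \<in> index_rel I \<nu> \<or> (j, i) \<in> index_rel I \<nu>"
      by (rule index_rel_total[OF lin i stable_index_in[OF j]])
    then have "\<nu> i f \<le> \<nu> j f"
    proof
      assume "(i, j) \<in> index_rel I \<nu>"
      then have "\<nu> i \<le> \<nu> j" by (simp add: index_rel_def)
      then show ?thesis by (rule le_funD)
    next
      assume "(j, i) \<in> index_rel I \<nu>"
      then show ?thesis using stable_indexD[OF j, of i] by simp
    qed
    then show "\<nu> i f \<le> sup_val I \<nu> f" using sup_val_eq[OF lin j] by simp
  qed
qed

end

theory Submission
  imports Defs "HOL-Library.Poly_Mapping"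
begin

text \<open>Inside the group ring \<open>A[\<Gamma>]\<close> of finitely supported functions \<open>\<Gamma> \<rightarrow> A\<close>, a valuation \<open>\<nu>\<close> on \<open>A\<close>
  singles out the Rees ring \<open>B\<^sub>\<nu>\<close> of those \<open>a\<close> with \<open>\<nu> (a\<^sub>\<gamma>) \<ge> \<gamma>\<close> for all \<open>\<gamma>\<close>.  Taking the class of
  every coefficient maps \<open>B\<^sub>\<nu>\<close> onto \<open>\<G>\<^sub>\<nu>\<close>, and the kernel \<open>N\<^sub>\<nu>\<close> consists of the \<open>a\<close> with
  \<open>\<nu> (a\<^sub>\<gamma>) > \<gamma>\<close> for all \<open>\<gamma>\<close>.  So \<open>\<G>\<^sub>\<nu> = B\<^sub>\<nu> / N\<^sub>\<nu>\<close>, and the ring axioms for \<open>\<G>\<^sub>\<nu>\<close> are inherited from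
  those of the group ring (\<open>graded_class_hom\<close>, \<open>graded_class_surj\<close>).

  If \<open>\<mu> \<le> \<nu>\<close> then \<open>B\<^sub>\<mu> \<subseteq> B\<^sub>\<nu>\<close> and \<open>N\<^sub>\<mu> \<subseteq> N\<^sub>\<nu>\<close>, and the map \<open>\<G>\<^sub>\<mu> \<rightarrow> \<G>\<^sub>\<nu>\<close> is the one that these
  inclusions induce (\<open>graded_map_graded_class\<close>): an initial form goes to zero exactly when the
  value of its representative jumps, that is, when the representative moves into \<open>N\<^sub>\<nu>\<close>.

  For a chain \<open>\<nu>\<^sub>i\<close> on which every element is stable, with supremum \<open>\<nu>\<close>, the finitely many
  coefficients of an element of the group ring are stable from a common index on.  From there on
  \<open>\<nu>\<^sub>i\<close> and \<open>\<nu>\<close> agree on them, whence \<open>B\<^sub>\<nu> = \<Union>\<^sub>i B\<^sub>i\<close> and \<open>N\<^sub>\<nu> = \<Union>\<^sub>i N\<^sub>i\<close>.  Hence the maps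
  \<open>\<G>\<^sub>i \<rightarrow> \<G>\<^sub>\<nu>\<close> are jointly surjective, and two elements with the same image in \<open>\<G>\<^sub>\<nu>\<close> already agree
  at a later index.  These two properties characterise a direct limit
  (\<open>dirlim_cring_and_iso\<close>).\<close>

section \<open>Direct limits computed by a cocone\<close>

text \<open>Under \<open>inj\<close> two pairs \<open>(i, a)\<close> and \<open>(j, b)\<close> are identified in the direct limit exactly if
  \<open>\<psi> i a = \<psi> j b\<close>.  The classes are therefore the fibres over \<open>S\<close> of the maps \<open>\<psi> i\<close> taken together,
  and sending an element of \<open>S\<close> to its fibre is an isomorphism, along which the ring axioms of \<open>S\<close>
  pass to the direct limit.\<close>

lemma dirlim_cring_and_iso:
  fixes R :: "'i \<Rightarrow> ('a, 'm) ring_scheme" and S :: "('b, 'n) ring_scheme"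
  assumes S: "cring S"
    and R: "\<And>i. i \<in> I \<Longrightarrow> ring (R i)"
    and directed: "\<And>i j. i \<in> I \<Longrightarrow> j \<in> I \<Longrightarrow> \<exists>k\<in>I. (i, k) \<in> r \<and> (j, k) \<in> r"
    and \<phi>: "\<And>i j a. i \<in> I \<Longrightarrow> j \<in> I \<Longrightarrow> (i, j) \<in> r \<Longrightarrow> a \<in> carrier (R i) \<Longrightarrow>
      \<phi> i j a \<in> carrier (R j)"
    and \<psi>: "\<And>i. i \<in> I \<Longrightarrow> \<psi> i \<in> ring_hom (R i) S"
    and cocone: "\<And>i j a. i \<in> I \<Longrightarrow> j \<in> I \<Longrightarrow> (i, j) \<in> r \<Longrightarrow> a \<in> carrier (R i) \<Longrightarrow>
      \<psi> j (\<phi> i j a) = \<psi> i a"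
    and surj: "\<And>s. s \<in> carrier S \<Longrightarrow> \<exists>i\<in>I. \<exists>a\<in>carrier (R i). \<psi> i a = s"
    and inj: "\<And>i j a b. i \<in> I \<Longrightarrow> j \<in> I \<Longrightarrow> a \<in> carrier (R i) \<Longrightarrow> b \<in> carrier (R j) \<Longrightarrow>
      \<psi> i a = \<psi> j b \<Longrightarrow> \<exists>k\<in>I. (i, k) \<in> r \<and> (j, k) \<in> r \<and> \<phi> i k a = \<phi> j k b"
  shows "cring (dirlim I r R \<phi>) \<and> dirlim I r R \<phi> \<simeq> S"
proof -
  interpret S: cring S by (rule S)
  \<comment> \<open>the isomorphism from \<open>S\<close> to the direct limit: \<open>s\<close> goes to its fibre\<close>
  define h where "h s = {(i, a). i \<in> I \<and> a \<in> carrier (R i) \<and> \<psi> i a = s}" for s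
  have \<psi>_closed: "\<psi> i a \<in> carrier S" if "i \<in> I" "a \<in> carrier (R i)" for i a
    using ring_hom_closed[OF \<psi>] that by blast
  have rel: "dirlim_rel I r R \<phi> =
      {((i, a), (j, b)). (i, a) \<in> (SIGMA i:I. carrier (R i)) \<and> (j, b) \<in> (SIGMA i:I. carrier (R i)) \<and>
        \<psi> i a = \<psi> j b}"
    (is "_ = ?ker")
  proof -
    have "((i, a), (j, b)) \<in> dirlim_rel I r R \<phi> \<longleftrightarrow> ((i, a), (j, b)) \<in> ?ker" for i a j b
      unfolding dirlim_rel_def using inj[of i j a b] by (auto; metis cocone)
    then show ?thesis by (intro equalityI subrelI) (simp_all only: split_paired_all)
  qed
  have cls: "dirlim_rel I r R \<phi> `` {(i, a)} = h (\<psi> i a)" if "i \<in> I" "a \<in> carrier (R i)" for i a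
    using that unfolding rel h_def by auto
  have ne: "\<exists>i a. (i, a) \<in> h s" if "s \<in> carrier S" for s
    using surj[OF that] by (auto simp: h_def)
  have op_h: "dirlim_op I r R \<phi> oper (h s) (h t) = h (sop s t)"
    if s: "s \<in> carrier S" and t: "t \<in> carrier S"
      and oper: "\<And>k a b. k \<in> I \<Longrightarrow> a \<in> carrier (R k) \<Longrightarrow> b \<in> carrier (R k) \<Longrightarrow>
        oper k a b \<in> carrier (R k) \<and> \<psi> k (oper k a b) = sop (\<psi> k a) (\<psi> k b)"
    for oper sop s t
  proof -
    \<comment> \<open>all classes in the union that defines the operation coincide\<close>
    have all: "dirlim_rel I r R \<phi> `` {(k, oper k (\<phi> i k a) (\<phi> j k b))} = h (sop s t)"
      if "(i, a) \<in> h s" "(j, b) \<in> h t" "k \<in> I" "(i, k) \<in> r" "(j, k) \<in> r" for i a j b k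
    proof -
      have ia: "i \<in> I" "a \<in> carrier (R i)" "\<psi> i a = s" and jb: "j \<in> I" "b \<in> carrier (R j)" "\<psi> j b = t"
        using that by (auto simp: h_def)
      show ?thesis
        using oper[OF that(3) \<phi>[OF ia(1) that(3,4) ia(2)] \<phi>[OF jb(1) that(3,5) jb(2)]] that(3) ia jb
        by (simp add: cls cocone that)
    qed
    obtain i a j b where ij: "(i, a) \<in> h s" "(j, b) \<in> h t" using ne[OF s] ne[OF t] by blast
    then obtain k where k: "k \<in> I" "(i, k) \<in> r" "(j, k) \<in> r"
      using directed[of i j] by (auto simp: h_def)
    show ?thesis
    proof (intro equalityI subsetI)
      fix x assume "x \<in> dirlim_op I r R \<phi> oper (h s) (h t)"
      then show "x \<in> h (sop s t)"
        unfolding dirlim_op_def using all by blast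
    next
      fix x assume "x \<in> h (sop s t)"
      then have "x \<in> dirlim_rel I r R \<phi> `` {(k, oper k (\<phi> i k a) (\<phi> j k b))}"
        using all[OF ij k] by simp
      then show "x \<in> dirlim_op I r R \<phi> oper (h s) (h t)"
        unfolding dirlim_op_def using ij k by blast
    qed
  qed
  obtain i0 where i0: "i0 \<in> I" using surj[OF S.zero_closed] by blast
  have const: "(\<Union>i\<in>I. dirlim_rel I r R \<phi> `` {(i, e i)}) = h s"
    if "\<And>i. i \<in> I \<Longrightarrow> e i \<in> carrier (R i) \<and> \<psi> i (e i) = s" for e s
  proof -
    have "dirlim_rel I r R \<phi> `` {(i, e i)} = h s" if "i \<in> I" for i
      using cls[OF that] \<open>\<And>i. i \<in> I \<Longrightarrow> e i \<in> carrier (R i) \<and> \<psi> i (e i) = s\<close>[OF that] by simp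
    then show ?thesis using i0 by auto
  qed
  have carr: "carrier (dirlim I r R \<phi>) = h ` carrier S"
  proof (intro equalityI subsetI)
    fix X assume "X \<in> carrier (dirlim I r R \<phi>)"
    then obtain i a where "i \<in> I" "a \<in> carrier (R i)" "X = dirlim_rel I r R \<phi> `` {(i, a)}"
      by (auto simp: dirlim_def quotient_def)
    then show "X \<in> h ` carrier S" using cls \<psi>_closed by auto
  next
    fix X assume "X \<in> h ` carrier S"
    then obtain s where "s \<in> carrier S" "X = h s" by blast
    then obtain i a where "i \<in> I" "a \<in> carrier (R i)" "X = h (\<psi> i a)" using surj by blast
    then show "X \<in> carrier (dirlim I r R \<phi>)"
      using cls[of i a] by (auto simp: dirlim_def quotient_def)
  qed
  have inj_h: "inj_on h (carrier S)"
  proof (rule inj_onI)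
    fix s t assume "s \<in> carrier S" "t \<in> carrier S" "h s = h t"
    then show "s = t" using ne[of s] by (auto simp: h_def)
  qed
  have iso: "h \<in> ring_iso S (dirlim I r R \<phi>)"
  proof (rule ring_iso_memI)
    fix s t assume st: "s \<in> carrier S" "t \<in> carrier S"
    show "h s \<in> carrier (dirlim I r R \<phi>)" using st carr by auto
    show "h (s \<otimes>\<^bsub>S\<^esub> t) = h s \<otimes>\<^bsub>dirlim I r R \<phi>\<^esub> h t"
      unfolding dirlim_def monoid.simps
      by (rule op_h[OF st, symmetric])
         (use R in \<open>auto simp: ring_hom_mult[OF \<psi>] dest: ring.ring_simprules(5)\<close>)
    show "h (s \<oplus>\<^bsub>S\<^esub> t) = h s \<oplus>\<^bsub>dirlim I r R \<phi>\<^esub> h t"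
      unfolding dirlim_def ring.simps
      by (rule op_h[OF st, symmetric])
         (use R in \<open>auto simp: ring_hom_add[OF \<psi>] dest: ring.ring_simprules(1)\<close>)
  next
    show "h \<one>\<^bsub>S\<^esub> = \<one>\<^bsub>dirlim I r R \<phi>\<^esub>"
      unfolding dirlim_def monoid.simps
      by (rule const[symmetric])
         (use R in \<open>auto simp: ring_hom_one[OF \<psi>] dest: ring.ring_simprules(6)\<close>)
    show "bij_betw h (carrier S) (carrier (dirlim I r R \<phi>))"
      using inj_h carr by (simp add: bij_betw_def)
  qed
  have "h \<zero>\<^bsub>S\<^esub> = \<zero>\<^bsub>dirlim I r R \<phi>\<^esub>"
    unfolding dirlim_def ring.simps
  proof (rule const[symmetric])
    fix i assume i: "i \<in> I"
    then show "\<zero>\<^bsub>R i\<^esub> \<in> carrier (R i) \<and> \<psi> i \<zero>\<^bsub>R i\<^esub> = \<zero>\<^bsub>S\<^esub>"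
      using ring_hom_zero[OF \<psi>[OF i] R[OF i] S.ring_axioms] ring.ring_simprules(2)[OF R[OF i]] by simp
  qed
  then have "cring (dirlim I r R \<phi>)"
    using S.ring_iso_imp_img_cring[OF iso] by simp
  moreover have "dirlim I r R \<phi> \<simeq> S"
    using ring_iso_sym[OF S.ring_axioms] iso unfolding is_ring_iso_def by blast
  ultimately show ?thesis ..
qed


section \<open>Cosets in one degree\<close>

lemma zero_mem_val_gt: "valuation \<nu> \<Longrightarrow> 0 \<in> val_gt \<nu> \<gamma>"
  by (simp add: val_gt_def valuation_zero)

lemma zero_mem_val_ge: "valuation \<nu> \<Longrightarrow> 0 \<in> val_ge \<nu> \<gamma>"
  by (simp add: val_ge_def valuation_zero)

lemma uminus_mem_val_ge: "valuation \<nu> \<Longrightarrow> f \<in> val_ge \<nu> \<gamma> \<Longrightarrow> - f \<in> val_ge \<nu> \<gamma>"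
  by (simp add: val_ge_def valuation_minus)

lemma mult_mem_val_ge:
  assumes "valuation \<nu>" "f \<in> val_ge \<nu> \<alpha>" "g \<in> val_ge \<nu> \<beta>"
  shows "f * g \<in> val_ge \<nu> (\<alpha> + \<beta>)"
  using assms(2,3) valuation_mult[OF assms(1), of f g]
  by (cases "\<nu> f"; cases "\<nu> g") (auto simp: val_ge_def add_mono)

lemma sum_mem_val_gt:
  assumes "valuation \<nu>" "\<And>p. p \<in> A \<Longrightarrow> f p \<in> val_gt \<nu> \<gamma>"
  shows "(\<Sum>p\<in>A. f p) \<in> val_gt \<nu> \<gamma>"
  using assms(2)
  by (induction A rule: infinite_finite_induct)
     (auto simp: zero_mem_val_gt[OF assms(1)] val_gt_add[OF assms(1)])

lemma sum_mem_val_ge: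
  assumes "valuation \<nu>" "\<And>p. p \<in> A \<Longrightarrow> f p \<in> val_ge \<nu> \<gamma>"
  shows "(\<Sum>p\<in>A. f p) \<in> val_ge \<nu> \<gamma>"
  using assms(2)
  by (induction A rule: infinite_finite_induct)
     (auto simp: zero_mem_val_ge[OF assms(1)] val_ge_add[OF assms(1)])

lemma val_ge_mono: "\<mu> \<le> \<nu> \<Longrightarrow> val_ge \<mu> \<gamma> \<subseteq> val_ge \<nu> \<gamma>"
  by (auto simp: val_ge_def le_fun_def intro: order_trans)

lemma val_gt_mono: "\<mu> \<le> \<nu> \<Longrightarrow> val_gt \<mu> \<gamma> \<subseteq> val_gt \<nu> \<gamma>"
  by (auto simp: val_gt_def le_fun_def intro: less_le_trans)

text \<open>So the graded piece of a degree that is not a value would be trivial.  This is why the Rees ring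
  below may use all degrees, although the graded ring only has components at values.\<close>

lemma val_gt_eq_val_ge:
  assumes "\<gamma> \<notin> val_values \<nu>"
  shows "val_gt \<nu> \<gamma> = val_ge \<nu> \<gamma>"
proof -
  have "\<nu> f \<noteq> Fin \<gamma>" for f
    using assms unfolding val_values_def val_supp_def
    by (metis (mono_tags, lifting) DiffI UNIV_I image_eqI infty.distinct(1) mem_Collect_eq)
  then show ?thesis
    unfolding val_gt_def val_ge_def by (intro Collect_cong) (metis order.order_iff_strict)
qed

lemma val_coset_eq_one_iff:
  assumes "valuation \<nu>"
  shows "val_coset \<nu> \<gamma> f = \<one>\<^bsub>graded_piece \<nu> \<gamma>\<^esub> \<longleftrightarrow> f \<in> val_gt \<nu> \<gamma>"
proof -
  have "\<one>\<^bsub>graded_piece \<nu> \<gamma>\<^esub> = val_coset \<nu> \<gamma> 0"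
    by (auto simp: one_graded_piece val_coset_altdef)
  then show ?thesis by (simp add: val_coset_eq_iff[OF assms])
qed

lemma val_coset_in_carrier: "f \<in> val_ge \<nu> \<gamma> \<Longrightarrow> val_coset \<nu> \<gamma> f \<in> carrier (graded_piece \<nu> \<gamma>)"
  by (simp add: carrier_graded_piece)

lemma val_coset_add:
  assumes "valuation \<nu>" "f \<in> val_ge \<nu> \<gamma>" "g \<in> val_ge \<nu> \<gamma>"
  shows "val_coset \<nu> \<gamma> f \<otimes>\<^bsub>graded_piece \<nu> \<gamma>\<^esub> val_coset \<nu> \<gamma> g = val_coset \<nu> \<gamma> (f + g)"
  using normal.rcos_sum[OF normal_val_gt[OF assms(1)], of f \<gamma> g] assms(2,3)
  by (simp add: graded_piece_def val_coset_def FactGroup_def val_ge_group_def)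

lemma val_coset_sum:
  assumes \<nu>: "valuation \<nu>" and f: "\<And>p. p \<in> A \<Longrightarrow> f p \<in> val_ge \<nu> \<gamma>" and A: "finite A"
  shows "finprod (graded_piece \<nu> \<gamma>) (\<lambda>p. val_coset \<nu> \<gamma> (f p)) A = val_coset \<nu> \<gamma> (\<Sum>p\<in>A. f p)"
  using A f
proof (induction A)
  interpret comm_group "graded_piece \<nu> \<gamma>" by (rule comm_group_graded_piece[OF \<nu>])
  case empty
  then show ?case using val_coset_eq_one_iff[OF \<nu>, of \<gamma> 0] by (simp add: zero_mem_val_gt[OF \<nu>])
next
  interpret comm_group "graded_piece \<nu> \<gamma>" by (rule comm_group_graded_piece[OF \<nu>])
  case (insert p A)
  have "finprod (graded_piece \<nu> \<gamma>) (\<lambda>p. val_coset \<nu> \<gamma> (f p)) (insert p A) =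
      val_coset \<nu> \<gamma> (f p) \<otimes>\<^bsub>graded_piece \<nu> \<gamma>\<^esub> val_coset \<nu> \<gamma> (\<Sum>p\<in>A. f p)"
    using insert by (subst finprod_insert) (auto intro!: val_coset_in_carrier)
  also have "\<dots> = val_coset \<nu> \<gamma> (f p + (\<Sum>p\<in>A. f p))"
    using insert.prems by (intro val_coset_add[OF \<nu>] sum_mem_val_ge[OF \<nu>]) auto
  finally show ?case using insert by simp
qed


section \<open>The graded ring as a quotient of the Rees ring\<close>

text \<open>The exponent ranges over the whole group \<open>\<Gamma>\<close>, not only over the values of \<open>\<nu>\<close>.  The rings of
  all valuations are then subrings of one and the same group ring, whose product is the
  convolution of \<open>Poly_Mapping\<close>.\<close>

definition rees_ring ::
  "('r::comm_ring_1 \<Rightarrow> 'g::linordered_ab_group_add infty) \<Rightarrow> ('g \<Rightarrow>\<^sub>0 'r) ring" where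
  "rees_ring \<nu> = \<lparr>carrier = {a. \<forall>\<gamma>. Poly_Mapping.lookup a \<gamma> \<in> val_ge \<nu> \<gamma>},
     mult = (*), one = 1, zero = 0, add = (+)\<rparr>"

definition graded_class ::
  "('r::comm_ring_1 \<Rightarrow> 'g::linordered_ab_group_add infty) \<Rightarrow> ('g \<Rightarrow>\<^sub>0 'r) \<Rightarrow> 'g \<Rightarrow> 'r set" where
  "graded_class \<nu> a = (\<lambda>\<gamma>\<in>val_values \<nu>. val_coset \<nu> \<gamma> (Poly_Mapping.lookup a \<gamma>))"

lemma rees_ring_simps [simp]:
  "x \<otimes>\<^bsub>rees_ring \<nu>\<^esub> y = x * y" "x \<oplus>\<^bsub>rees_ring \<nu>\<^esub> y = x + y"
  "\<one>\<^bsub>rees_ring \<nu>\<^esub> = 1" "\<zero>\<^bsub>rees_ring \<nu>\<^esub> = 0"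
  by (simp_all add: rees_ring_def)

lemma mem_rees_ring:
  "a \<in> carrier (rees_ring \<nu>) \<longleftrightarrow> (\<forall>\<gamma>. Poly_Mapping.lookup a \<gamma> \<in> val_ge \<nu> \<gamma>)"
  by (simp add: rees_ring_def)

lemma lookup_mult_keys:
  fixes a b :: "'g::comm_monoid_add \<Rightarrow>\<^sub>0 'r::comm_semiring_0"
  shows "Poly_Mapping.lookup (a * b) \<gamma> =
    (\<Sum>(\<alpha>, \<beta>)\<in>{(\<alpha>, \<beta>). \<alpha> \<in> Poly_Mapping.keys a \<and> \<beta> \<in> Poly_Mapping.keys b \<and> \<alpha> + \<beta> = \<gamma>}.
       Poly_Mapping.lookup a \<alpha> * Poly_Mapping.lookup b \<beta>)"
  (is "_ = sum ?f ?A")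
proof -
  have fin: "finite ?A"
    by (rule finite_subset[of _ "Poly_Mapping.keys a \<times> Poly_Mapping.keys b"]) auto
  have "Poly_Mapping.lookup (a * b) \<gamma> = Sum_any (\<lambda>(\<alpha>, \<beta>).
      Poly_Mapping.lookup a \<alpha> * Poly_Mapping.lookup b \<beta> when \<gamma> = \<alpha> + \<beta>)"
    by (simp add: times_poly_mapping.rep_eq prod_fun_unfold_prod)
  also have "\<dots> = (\<Sum>p\<in>?A. case p of (\<alpha>, \<beta>) \<Rightarrow>
      (Poly_Mapping.lookup a \<alpha> * Poly_Mapping.lookup b \<beta> when \<gamma> = \<alpha> + \<beta>))"
    by (rule Sum_any.expand_superset[OF fin])
       (auto simp: in_keys_iff when_def split: if_splits)
  also have "\<dots> = sum ?f ?A"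
    by (rule sum.cong) auto
  finally show ?thesis .
qed

lemma cring_rees_ring:
  assumes \<nu>: "valuation \<nu>"
  shows "cring (rees_ring \<nu>)"
proof (rule cringI)
  show "abelian_group (rees_ring \<nu>)"
  proof (rule abelian_groupI)
    fix a assume a: "a \<in> carrier (rees_ring \<nu>)"
    have "- a \<in> carrier (rees_ring \<nu>)" using a by (simp add: mem_rees_ring uminus_mem_val_ge[OF \<nu>])
    then show "\<exists>b\<in>carrier (rees_ring \<nu>). b \<oplus>\<^bsub>rees_ring \<nu>\<^esub> a = \<zero>\<^bsub>rees_ring \<nu>\<^esub>"
      by (intro bexI[of _ "- a"]) simp_all
  qed (auto simp: mem_rees_ring lookup_add val_ge_add[OF \<nu>] zero_mem_val_ge[OF \<nu>] algebra_simps)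
  show "comm_monoid (rees_ring \<nu>)"
  proof (rule comm_monoidI)
    fix a b assume ab: "a \<in> carrier (rees_ring \<nu>)" "b \<in> carrier (rees_ring \<nu>)"
    show "a \<otimes>\<^bsub>rees_ring \<nu>\<^esub> b \<in> carrier (rees_ring \<nu>)"
      unfolding mem_rees_ring rees_ring_simps lookup_mult_keys
      using ab by (intro allI sum_mem_val_ge[OF \<nu>]) (auto simp: mem_rees_ring mult_mem_val_ge[OF \<nu>])
  next
    show "\<one>\<^bsub>rees_ring \<nu>\<^esub> \<in> carrier (rees_ring \<nu>)"
      by (auto simp: mem_rees_ring lookup_one when_def zero_mem_val_ge[OF \<nu>])
         (simp add: val_ge_def valuation_one[OF \<nu>])
  qed (auto simp: algebra_simps)
qed (auto simp: algebra_simps)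

text \<open>This determines the kernel of \<open>graded_class \<nu>\<close>.  The left-hand side only compares the degrees in
  \<open>val_values \<nu>\<close>; in all others \<open>val_gt \<nu> \<gamma> = val_ge \<nu> \<gamma>\<close>, which contains both coefficients.\<close>

lemma graded_class_eq_iff:
  assumes \<nu>: "valuation \<nu>" and ab: "a \<in> carrier (rees_ring \<nu>)" "b \<in> carrier (rees_ring \<nu>)"
  shows "graded_class \<nu> a = graded_class \<nu> b \<longleftrightarrow>
    (\<forall>\<gamma>. Poly_Mapping.lookup a \<gamma> - Poly_Mapping.lookup b \<gamma> \<in> val_gt \<nu> \<gamma>)"
proof -
  have "Poly_Mapping.lookup a \<gamma> - Poly_Mapping.lookup b \<gamma> \<in> val_gt \<nu> \<gamma>" if "\<gamma> \<notin> val_values \<nu>" for \<gamma>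
    unfolding val_gt_eq_val_ge[OF that]
    using ab val_ge_add[OF \<nu> _ uminus_mem_val_ge[OF \<nu>]] by (force simp: mem_rees_ring)
  then have "(\<forall>\<gamma>. Poly_Mapping.lookup a \<gamma> - Poly_Mapping.lookup b \<gamma> \<in> val_gt \<nu> \<gamma>) \<longleftrightarrow>
      (\<forall>\<gamma>\<in>val_values \<nu>. graded_class \<nu> a \<gamma> = graded_class \<nu> b \<gamma>)"
    by (simp add: graded_class_def val_coset_eq_iff[OF \<nu>]) blast
  also have "\<dots> \<longleftrightarrow> graded_class \<nu> a = graded_class \<nu> b"
  proof
    assume "\<forall>\<gamma>\<in>val_values \<nu>. graded_class \<nu> a \<gamma> = graded_class \<nu> b \<gamma>"
    then show "graded_class \<nu> a = graded_class \<nu> b"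
      by (intro ext) (metis graded_class_def restrict_apply)
  qed simp
  finally show ?thesis by blast
qed

lemma carrier_graded_ring:
  assumes "valuation \<nu>"
  shows "carrier (graded_ring \<nu>) = {c \<in> \<Pi>\<^sub>E \<gamma>\<in>val_values \<nu>. carrier (graded_piece \<nu> \<gamma>).
    finite {\<gamma> \<in> val_values \<nu>. c \<gamma> \<noteq> \<one>\<^bsub>graded_piece \<nu> \<gamma>\<^esub>}}"
  using comm_group_graded_piece[OF assms]
  by (simp add: graded_ring_def carrier_sum_group comm_group_def)

lemma graded_class_support:
  assumes "valuation \<nu>" "\<gamma> \<in> val_values \<nu>" "graded_class \<nu> a \<gamma> \<noteq> \<one>\<^bsub>graded_piece \<nu> \<gamma>\<^esub>"
  shows "\<gamma> \<in> Poly_Mapping.keys a"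
  using assms zero_mem_val_gt[OF assms(1), of \<gamma>]
  by (auto simp: graded_class_def val_coset_eq_one_iff in_keys_iff)

text \<open>Both sides sum products of coefficients over pairs of degrees with sum \<open>\<gamma>\<close>.  The convolution
  runs over all pairs of non-zero coefficients, the product of the graded ring over the pairs of
  non-zero classes.  A pair in the difference has a factor of value larger than its degree, so its
  product vanishes in degree \<open>\<gamma>\<close>.\<close>

lemma graded_class_mult:
  assumes \<nu>: "valuation \<nu>" and a: "a \<in> carrier (rees_ring \<nu>)" and b: "b \<in> carrier (rees_ring \<nu>)"
  shows "graded_class \<nu> (a * b) = graded_mult \<nu> (graded_class \<nu> a) (graded_class \<nu> b)"
proof
  fix \<gamma>
  let ?a = "Poly_Mapping.lookup a" and ?b = "Poly_Mapping.lookup b"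
  note A = a[unfolded mem_rees_ring, rule_format] and B = b[unfolded mem_rees_ring, rule_format]
  let ?K = "{(\<alpha>, \<beta>). \<alpha> \<in> Poly_Mapping.keys a \<and> \<beta> \<in> Poly_Mapping.keys b \<and> \<alpha> + \<beta> = \<gamma>}"
  let ?P = "{(\<alpha>, \<beta>). \<alpha> \<in> val_values \<nu> \<and> \<beta> \<in> val_values \<nu> \<and> \<alpha> + \<beta> = \<gamma> \<and>
     graded_class \<nu> a \<alpha> \<noteq> \<one>\<^bsub>graded_piece \<nu> \<alpha>\<^esub> \<and> graded_class \<nu> b \<beta> \<noteq> \<one>\<^bsub>graded_piece \<nu> \<beta>\<^esub>}"
  have K: "finite ?K"
    by (rule finite_subset[of _ "Poly_Mapping.keys a \<times> Poly_Mapping.keys b"]) auto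
  have PK: "?P \<subseteq> ?K" using graded_class_support[OF \<nu>] by blast
  let ?m = "\<lambda>(\<alpha>, \<beta>). ?a \<alpha> * ?b \<beta>"
  show "graded_class \<nu> (a * b) \<gamma> = graded_mult \<nu> (graded_class \<nu> a) (graded_class \<nu> b) \<gamma>"
  proof (cases "\<gamma> \<in> val_values \<nu>")
    case True
    interpret comm_group "graded_piece \<nu> \<gamma>" by (rule comm_group_graded_piece[OF \<nu>])
    have "graded_mult \<nu> (graded_class \<nu> a) (graded_class \<nu> b) \<gamma> =
        finprod (graded_piece \<nu> \<gamma>) (\<lambda>p. val_coset \<nu> \<gamma> (?m p)) ?P"
      unfolding graded_mult_def restrict_apply'[OF True]
    proof (rule finprod_cong'[OF refl], goal_cases)
      case 1
      show ?case
        using mult_mem_val_ge[OF \<nu> A B] by (auto intro!: val_coset_in_carrier)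
    next
      case (2 p)
      then show ?case
        by (auto simp: graded_class_def coset_mult_coset[OF \<nu> A B])
    qed
    also have "\<dots> = val_coset \<nu> \<gamma> (sum ?m ?P)"
      using mult_mem_val_ge[OF \<nu> A B] finite_subset[OF PK K] by (intro val_coset_sum[OF \<nu>]) auto
    also have "\<dots> = val_coset \<nu> \<gamma> (sum ?m ?K)"
    proof -
      have gt: "?m p \<in> val_gt \<nu> \<gamma>" if "p \<in> ?K - ?P" for p
      proof -
        obtain \<alpha> \<beta> where p: "p = (\<alpha>, \<beta>)" "\<alpha> + \<beta> = \<gamma>" using \<open>p \<in> ?K - ?P\<close> by auto
        have "?a \<alpha> \<in> val_gt \<nu> \<alpha> \<or> ?b \<beta> \<in> val_gt \<nu> \<beta>"
        proof (rule ccontr)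
          assume n: "\<not> ?thesis"
          then have "\<alpha> \<in> val_values \<nu>" "\<beta> \<in> val_values \<nu>"
            using val_gt_eq_val_ge A B by blast+
          then have "p \<in> ?P"
            using n p by (simp add: graded_class_def val_coset_eq_one_iff[OF \<nu>])
          then show False using that by blast
        qed
        then show ?thesis
          using p mult_mem_val_gt(1)[OF \<nu> _ B, of "?a \<alpha>" \<alpha> \<beta>]
            mult_mem_val_gt(2)[OF \<nu> _ A, of "?b \<beta>" \<beta> \<alpha>] by (auto simp: add.commute)
      qed
      have "sum ?m ?K = sum ?m ?P + sum ?m (?K - ?P)"
        using sum.subset_diff[OF PK K, of ?m] by (simp only: add.commute)
      moreover have "sum ?m (?K - ?P) \<in> val_gt \<nu> \<gamma>"
        by (rule sum_mem_val_gt[OF \<nu> gt])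
      moreover have "val_coset \<nu> \<gamma> y = val_coset \<nu> \<gamma> x" if "x = y + z" "z \<in> val_gt \<nu> \<gamma>" for x y z
        using that val_coset_eq_iff[OF \<nu>, of \<gamma> x y] by simp
      ultimately show ?thesis by blast
    qed
    finally show ?thesis
      unfolding graded_class_def restrict_apply'[OF True] lookup_mult_keys by (rule sym)
  qed (simp add: graded_class_def graded_mult_def)
qed

lemma graded_class_hom:
  assumes \<nu>: "valuation \<nu>"
  shows "graded_class \<nu> \<in> ring_hom (rees_ring \<nu>) (graded_ring \<nu>)"
proof (rule ring_hom_memI)
  fix a b assume a: "a \<in> carrier (rees_ring \<nu>)" and b: "b \<in> carrier (rees_ring \<nu>)"
  have "{\<gamma> \<in> val_values \<nu>. graded_class \<nu> a \<gamma> \<noteq> \<one>\<^bsub>graded_piece \<nu> \<gamma>\<^esub>} \<subseteq> Poly_Mapping.keys a"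
    using graded_class_support[OF \<nu>] by blast
  then have "finite {\<gamma> \<in> val_values \<nu>. graded_class \<nu> a \<gamma> \<noteq> \<one>\<^bsub>graded_piece \<nu> \<gamma>\<^esub>}"
    by (rule finite_subset) (rule finite_keys)
  moreover have "graded_class \<nu> a \<in> (\<Pi>\<^sub>E \<gamma>\<in>val_values \<nu>. carrier (graded_piece \<nu> \<gamma>))"
    using a by (auto simp: graded_class_def mem_rees_ring val_coset_in_carrier)
  ultimately show "graded_class \<nu> a \<in> carrier (graded_ring \<nu>)"
    by (simp add: carrier_graded_ring[OF \<nu>])
  show "graded_class \<nu> (a \<otimes>\<^bsub>rees_ring \<nu>\<^esub> b) = graded_class \<nu> a \<otimes>\<^bsub>graded_ring \<nu>\<^esub> graded_class \<nu> b"
    using graded_class_mult[OF \<nu> a b] by (simp add: graded_ring_def)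
  show "graded_class \<nu> (a \<oplus>\<^bsub>rees_ring \<nu>\<^esub> b) = graded_class \<nu> a \<oplus>\<^bsub>graded_ring \<nu>\<^esub> graded_class \<nu> b"
    using a b
    by (auto simp: graded_ring_def graded_class_def lookup_add val_coset_add[OF \<nu>] mem_rees_ring fun_eq_iff)
next
  have "val_coset \<nu> \<gamma> 0 = \<one>\<^bsub>graded_piece \<nu> \<gamma>\<^esub>" for \<gamma>
    by (simp add: val_coset_eq_one_iff[OF \<nu>] zero_mem_val_gt[OF \<nu>])
  then show "graded_class \<nu> \<one>\<^bsub>rees_ring \<nu>\<^esub> = \<one>\<^bsub>graded_ring \<nu>\<^esub>"
    unfolding graded_class_def graded_ring_def initial_form_def rees_ring_simps monoid.simps
    by (intro restrict_ext) (simp add: lookup_one valuation_one[OF \<nu>])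
qed

lemma graded_class_surj:
  assumes \<nu>: "valuation \<nu>"
  shows "graded_class \<nu> ` carrier (rees_ring \<nu>) = carrier (graded_ring \<nu>)"
proof (intro equalityI subsetI)
  fix c assume "c \<in> graded_class \<nu> ` carrier (rees_ring \<nu>)"
  then show "c \<in> carrier (graded_ring \<nu>)" using ring_hom_closed[OF graded_class_hom[OF \<nu>]] by blast
next
  fix c assume "c \<in> carrier (graded_ring \<nu>)"
  then have c: "c \<in> (\<Pi>\<^sub>E \<gamma>\<in>val_values \<nu>. carrier (graded_piece \<nu> \<gamma>))"
    and fin: "finite {\<gamma> \<in> val_values \<nu>. c \<gamma> \<noteq> \<one>\<^bsub>graded_piece \<nu> \<gamma>\<^esub>}" (is "finite ?T")
    by (simp_all add: carrier_graded_ring[OF \<nu>])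
  have "\<exists>f. f \<in> val_ge \<nu> \<gamma> \<and> c \<gamma> = val_coset \<nu> \<gamma> f" if "\<gamma> \<in> val_values \<nu>" for \<gamma>
    using c that by (force simp: carrier_graded_piece)
  then obtain f where f: "\<And>\<gamma>. \<gamma> \<in> val_values \<nu> \<Longrightarrow> f \<gamma> \<in> val_ge \<nu> \<gamma> \<and> c \<gamma> = val_coset \<nu> \<gamma> (f \<gamma>)"
    by metis
  define a where "a = Abs_poly_mapping (\<lambda>\<gamma>. if \<gamma> \<in> ?T then f \<gamma> else 0)"
  have a: "Poly_Mapping.lookup a = (\<lambda>\<gamma>. if \<gamma> \<in> ?T then f \<gamma> else 0)"
    unfolding a_def by (rule lookup_Abs_poly_mapping) (rule finite_subset[OF _ fin], auto)
  have 0: "val_coset \<nu> \<gamma> 0 = \<one>\<^bsub>graded_piece \<nu> \<gamma>\<^esub>" for \<gamma>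
    by (simp add: val_coset_eq_one_iff[OF \<nu>] zero_mem_val_gt[OF \<nu>])
  have "graded_class \<nu> a \<gamma> = c \<gamma>" for \<gamma>
    using c f[of \<gamma>] 0 by (cases "\<gamma> \<in> val_values \<nu>") (auto simp: graded_class_def a PiE_def extensional_def)
  moreover have "a \<in> carrier (rees_ring \<nu>)"
    using f by (simp add: mem_rees_ring a zero_mem_val_ge[OF \<nu>])
  ultimately show "c \<in> graded_class \<nu> ` carrier (rees_ring \<nu>)" by (metis ext imageI)
qed

lemma graded_class_lift:
  assumes "valuation \<nu>" "c \<in> carrier (graded_ring \<nu>)"
  obtains a where "a \<in> carrier (rees_ring \<nu>)" "c = graded_class \<nu> a"
  using assms(2) unfolding graded_class_surj[OF assms(1), symmetric] by (rule imageE)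

lemma graded_class_zero:
  assumes "valuation \<nu>"
  shows "graded_class \<nu> 0 = \<zero>\<^bsub>graded_ring \<nu>\<^esub>"
proof -
  have "val_coset \<nu> \<gamma> 0 = \<one>\<^bsub>graded_piece \<nu> \<gamma>\<^esub>" for \<gamma>
    by (simp add: val_coset_eq_one_iff[OF assms] zero_mem_val_gt[OF assms])
  then show ?thesis by (simp add: graded_class_def graded_ring_def)
qed

lemma cring_graded_ring:
  assumes \<nu>: "valuation \<nu>"
  shows "cring (graded_ring \<nu>)"
proof -
  interpret B: cring "rees_ring \<nu>" by (rule cring_rees_ring[OF \<nu>])
  have "ring (graded_ring \<nu>)"
    using B.ring_hom_imp_img_ring[OF graded_class_hom[OF \<nu>]]
    unfolding graded_class_surj[OF \<nu>] rees_ring_simps graded_class_zero[OF \<nu>] by simp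
  moreover have "c \<otimes>\<^bsub>graded_ring \<nu>\<^esub> d = d \<otimes>\<^bsub>graded_ring \<nu>\<^esub> c"
    if c: "c \<in> carrier (graded_ring \<nu>)" and d: "d \<in> carrier (graded_ring \<nu>)" for c d
  proof -
    obtain a where "a \<in> carrier (rees_ring \<nu>)" "c = graded_class \<nu> a"
      using graded_class_lift[OF \<nu> c] .
    moreover obtain b where "b \<in> carrier (rees_ring \<nu>)" "d = graded_class \<nu> b"
      using graded_class_lift[OF \<nu> d] .
    ultimately show ?thesis
      using ring_hom_mult[OF graded_class_hom[OF \<nu>]] B.m_comm by metis
  qed
  ultimately show ?thesis
    by (intro cring.intro comm_monoid.intro comm_monoid_axioms.intro) (auto simp: ring_def)
qed


section \<open>The maps of the direct system on the Rees rings\<close>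

lemma rees_ring_mono: "\<mu> \<le> \<nu> \<Longrightarrow> carrier (rees_ring \<mu>) \<subseteq> carrier (rees_ring \<nu>)"
  using val_ge_mono by (fastforce simp: mem_rees_ring)

lemma single_in_rees_ring:
  "valuation \<nu> \<Longrightarrow> f \<in> val_ge \<nu> \<gamma> \<Longrightarrow> Poly_Mapping.single \<gamma> f \<in> carrier (rees_ring \<nu>)"
  by (auto simp: mem_rees_ring lookup_single when_def zero_mem_val_ge)

text \<open>The case distinction is the one in the definition of \<open>graded_map\<close>: the class of a single term is
  an initial form as long as the value of its coefficient is the degree, and vanishes as soon as
  the value is larger.\<close>

lemma graded_class_single:
  assumes \<nu>: "valuation \<nu>" and f: "f \<in> val_ge \<nu> \<gamma>"
  shows "graded_class \<nu> (Poly_Mapping.single \<gamma> f) =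
    (if \<nu> f = Fin \<gamma> then initial_form \<nu> f else \<zero>\<^bsub>graded_ring \<nu>\<^esub>)"
proof -
  have 0: "val_coset \<nu> \<delta> 0 = \<one>\<^bsub>graded_piece \<nu> \<delta>\<^esub>" for \<delta>
    by (simp add: val_coset_eq_one_iff[OF \<nu>] zero_mem_val_gt[OF \<nu>])
  show ?thesis
  proof (cases "\<nu> f = Fin \<gamma>")
    case True
    then show ?thesis
      unfolding graded_class_def initial_form_def lookup_single when_def
      by (simp only: if_True simp_thms infty.inject) (intro restrict_ext, simp add: 0)
  next
    case False
    then have "f \<in> val_gt \<nu> \<gamma>" using f by (auto simp: val_gt_def val_ge_def)
    then have "val_coset \<nu> \<gamma> f = \<one>\<^bsub>graded_piece \<nu> \<gamma>\<^esub>" by (simp add: val_coset_eq_one_iff[OF \<nu>])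
    then have "val_coset \<nu> \<delta> (Poly_Mapping.lookup (Poly_Mapping.single \<gamma> f) \<delta>) = \<one>\<^bsub>graded_piece \<nu> \<delta>\<^esub>" for \<delta>
      by (cases "\<gamma> = \<delta>") (simp_all add: lookup_single 0)
    then show ?thesis
      using False by (simp add: graded_class_def graded_ring_def)
  qed
qed

lemma graded_class_sum:
  assumes \<nu>: "valuation \<nu>" and x: "\<And>t. t \<in> T \<Longrightarrow> x t \<in> carrier (rees_ring \<nu>)" and T: "finite T"
  shows "(\<Sum>t\<in>T. x t) \<in> carrier (rees_ring \<nu>) \<and>
    (\<Oplus>\<^bsub>graded_ring \<nu>\<^esub>t\<in>T. graded_class \<nu> (x t)) = graded_class \<nu> (\<Sum>t\<in>T. x t)"
  using T x
proof (induction T)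
  interpret B: cring "rees_ring \<nu>" by (rule cring_rees_ring[OF \<nu>])
  interpret G: cring "graded_ring \<nu>" by (rule cring_graded_ring[OF \<nu>])
  case empty
  then show ?case using B.zero_closed by (simp add: graded_class_zero[OF \<nu>])
next
  interpret B: cring "rees_ring \<nu>" by (rule cring_rees_ring[OF \<nu>])
  interpret G: cring "graded_ring \<nu>" by (rule cring_graded_ring[OF \<nu>])
  note hom = graded_class_hom[OF \<nu>]
  case (insert t T)
  then have s: "x t \<in> carrier (rees_ring \<nu>)" "(\<Sum>t\<in>T. x t) \<in> carrier (rees_ring \<nu>)" by auto
  have "(\<Oplus>\<^bsub>graded_ring \<nu>\<^esub>t\<in>insert t T. graded_class \<nu> (x t)) =
      graded_class \<nu> (x t) \<oplus>\<^bsub>graded_ring \<nu>\<^esub> (\<Oplus>\<^bsub>graded_ring \<nu>\<^esub>t\<in>T. graded_class \<nu> (x t))"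
    using insert.hyps insert.prems by (intro G.finsum_insert) (auto intro!: ring_hom_closed[OF hom])
  then show ?case
    using insert ring_hom_add[OF hom s] B.a_closed[OF s] by simp
qed

text \<open>The left-hand side is the class of \<open>b = \<Sum>\<gamma>. f\<^sub>\<gamma> t\<^sup>\<gamma>\<close>, where \<open>f\<^sub>\<gamma>\<close> is the representative chosen for
  the non-zero component of degree \<open>\<gamma>\<close>: each summand in the definition of \<open>graded_map\<close> is the class
  of a single term (\<open>graded_class_single\<close>), as \<open>f\<^sub>\<gamma>\<close> has \<open>\<mu>\<close>-value exactly \<open>\<gamma>\<close>.  The coefficients of
  \<open>b - a\<close> have \<open>\<mu>\<close>-values larger than their degrees, hence also such \<open>\<nu>\<close>-values.\<close>

lemma graded_map_graded_class:
  assumes \<mu>: "valuation \<mu>" and \<nu>: "valuation \<nu>" and le: "\<mu> \<le> \<nu>"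
    and a: "a \<in> carrier (rees_ring \<mu>)"
  shows "graded_map \<mu> \<nu> (graded_class \<mu> a) = graded_class \<nu> a"
proof -
  let ?c = "graded_class \<mu> a" and ?a = "Poly_Mapping.lookup a"
  define T where "T = {\<gamma> \<in> val_values \<mu>. ?c \<gamma> \<noteq> \<one>\<^bsub>graded_piece \<mu> \<gamma>\<^esub>}"
  define f where "f \<gamma> = (SOME f. f \<in> ?c \<gamma>)" for \<gamma>
  have finT: "finite T"
    unfolding T_def by (rule finite_subset[OF _ finite_keys[of a]]) (use graded_class_support[OF \<mu>] in blast)
  have a_ge: "?a \<gamma> \<in> val_ge \<mu> \<gamma>" for \<gamma> using a by (simp add: mem_rees_ring)
  have T_iff: "\<gamma> \<in> T \<longleftrightarrow> ?a \<gamma> \<notin> val_gt \<mu> \<gamma>" for \<gamma>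
  proof (cases "\<gamma> \<in> val_values \<mu>")
    case True
    then show ?thesis
      unfolding T_def mem_Collect_eq graded_class_def restrict_apply'[OF True]
      by (simp only: val_coset_eq_one_iff[OF \<mu>] simp_thms)
  next
    case False
    then show ?thesis using val_gt_eq_val_ge[OF False] a_ge by (simp add: T_def)
  qed
  have d: "f \<gamma> - ?a \<gamma> \<in> val_gt \<mu> \<gamma>" if "\<gamma> \<in> T" for \<gamma>
  proof -
    have c: "?c \<gamma> = val_coset \<mu> \<gamma> (?a \<gamma>)" using that by (simp add: T_def graded_class_def)
    have "?a \<gamma> \<in> ?c \<gamma>" unfolding c by (simp add: mem_val_coset_iff zero_mem_val_gt[OF \<mu>])
    then have "f \<gamma> \<in> ?c \<gamma>" unfolding f_def by (rule someI)
    then show ?thesis unfolding c by (simp add: mem_val_coset_iff)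
  qed
  have f_ge: "f \<gamma> \<in> val_ge \<mu> \<gamma>" if "\<gamma> \<in> T" for \<gamma>
    using val_ge_add[OF \<mu> _ a_ge, of "f \<gamma> - ?a \<gamma>" \<gamma>] d[OF that] val_gt_subset[of \<mu> \<gamma>] by auto
  have f_val: "\<mu> (f \<gamma>) = Fin \<gamma>" if "\<gamma> \<in> T" for \<gamma>
  proof (rule ccontr)
    assume "\<mu> (f \<gamma>) \<noteq> Fin \<gamma>"
    then have "f \<gamma> \<in> val_gt \<mu> \<gamma>" using f_ge[OF that] by (auto simp: val_gt_def val_ge_def)
    moreover have "- (f \<gamma> - ?a \<gamma>) \<in> val_gt \<mu> \<gamma>"
      using d[OF that] unfolding val_gt_def mem_Collect_eq valuation_minus[OF \<mu>] .
    ultimately have "?a \<gamma> \<in> val_gt \<mu> \<gamma>"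
      using val_gt_add[OF \<mu>, of "f \<gamma>" \<gamma> "- (f \<gamma> - ?a \<gamma>)"] by simp
    then show False using that by (simp add: T_iff)
  qed
  define b where "b = (\<Sum>\<gamma>\<in>T. Poly_Mapping.single \<gamma> (f \<gamma>))"
  have ge: "f \<gamma> \<in> val_ge \<nu> \<gamma>" if "\<gamma> \<in> T" for \<gamma>
    using f_ge[OF that] val_ge_mono[OF le] by blast
  interpret G: cring "graded_ring \<nu>" by (rule cring_graded_ring[OF \<nu>])
  have sum: "b \<in> carrier (rees_ring \<nu>) \<and>
      (\<Oplus>\<^bsub>graded_ring \<nu>\<^esub>\<gamma>\<in>T. graded_class \<nu> (Poly_Mapping.single \<gamma> (f \<gamma>))) = graded_class \<nu> b"
    unfolding b_def using single_in_rees_ring[OF \<nu> ge] by (intro graded_class_sum[OF \<nu> _ finT]) auto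
  have "graded_map \<mu> \<nu> ?c =
      (\<Oplus>\<^bsub>graded_ring \<nu>\<^esub>\<gamma>\<in>T. graded_class \<nu> (Poly_Mapping.single \<gamma> (f \<gamma>)))"
    unfolding graded_map_def T_def[symmetric] Let_def f_def[symmetric]
    using ring_hom_closed[OF graded_class_hom[OF \<nu>] single_in_rees_ring[OF \<nu> ge]]
    by (intro G.finsum_cong') (auto simp: graded_class_single[OF \<nu> ge] f_val)
  also have "\<dots> = graded_class \<nu> b" using sum by blast
  also have "\<dots> = graded_class \<nu> a"
  proof (subst graded_class_eq_iff[OF \<nu>])
    show "b \<in> carrier (rees_ring \<nu>)" "a \<in> carrier (rees_ring \<nu>)"
      using sum a rees_ring_mono[OF le] by auto
    show "\<forall>\<gamma>. Poly_Mapping.lookup b \<gamma> - ?a \<gamma> \<in> val_gt \<nu> \<gamma>"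
    proof
      fix \<gamma>
      have b: "Poly_Mapping.lookup b \<gamma> = (if \<gamma> \<in> T then f \<gamma> else 0)"
        using finT by (simp add: b_def lookup_sum lookup_single when_def)
      have "Poly_Mapping.lookup b \<gamma> - ?a \<gamma> \<in> val_gt \<mu> \<gamma>"
      proof (cases "\<gamma> \<in> T")
        case True
        then show ?thesis using b d by simp
      next
        case False
        then have "?a \<gamma> \<in> val_gt \<mu> \<gamma>" by (simp add: T_iff)
        then show ?thesis using b False by (simp add: val_gt_def valuation_minus[OF \<mu>])
      qed
      then show "Poly_Mapping.lookup b \<gamma> - ?a \<gamma> \<in> val_gt \<nu> \<gamma>" using val_gt_mono[OF le] by blast
    qed
  qed
  finally show ?thesis .
qed


section \<open>The graded ring of the supremum\<close>

theorem corollary4p11: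
  fixes \<nu>\<^sub>0 :: "'k::field \<Rightarrow> 'g::linordered_ab_group_add infty"
    and I :: "'i set"
    and \<nu> :: "'i \<Rightarrow> 'k poly \<Rightarrow> 'g infty"
  assumes "divisible TYPE('g)"
    and "valuation \<nu>\<^sub>0" and "val_supp \<nu>\<^sub>0 = {0}"
    and "I \<noteq> {}"
    and "\<forall>i\<in>I. \<nu> i \<in> extensions \<nu>\<^sub>0"
    and "linear_order_on I (index_rel I \<nu>)"
    and "\<forall>f. fam_stable I \<nu> f"
  shows "cring (dirlim I (index_rel I \<nu>) (\<lambda>i. graded_ring (\<nu> i)) (\<lambda>i j. graded_map (\<nu> i) (\<nu> j))) \<and>
         cring (graded_ring (sup_val I \<nu>)) \<and>
         dirlim I (index_rel I \<nu>) (\<lambda>i. graded_ring (\<nu> i)) (\<lambda>i j. graded_map (\<nu> i) (\<nu> j))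
           \<simeq> graded_ring (sup_val I \<nu>)"
proof -
  note ne = assms(4) and lin = assms(6) and st = assms(7)
  let ?s = "sup_val I \<nu>"
  have s: "valuation ?s"
    using sup_val_in_extensions[OF lin ne st assms(5)] by (simp add: extensions_def)
  have v: "valuation (\<nu> i)" if "i \<in> I" for i
    using assms(5) that by (simp add: extensions_def)
  have le: "\<nu> i \<le> ?s" if "i \<in> I" for i
    by (rule sup_val_least_upper_bound(1)[OF lin st that])
  have rI: "\<nu> i \<le> \<nu> j" if "(i, j) \<in> index_rel I \<nu>" for i j
    using that by (simp add: index_rel_def)
  have trans: "(i, k) \<in> index_rel I \<nu>" if "(i, j) \<in> index_rel I \<nu>" "(j, k) \<in> index_rel I \<nu>" for i j k
    using that by (auto simp: index_rel_def)
  have directed: "\<exists>k\<in>I. (i, k) \<in> index_rel I \<nu> \<and> (j, k) \<in> index_rel I \<nu>" if "i \<in> I" "j \<in> I" for i j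
    using index_rel_total[OF lin that] that by (auto simp: index_rel_def)
  note map = graded_map_graded_class[OF v v rI] and map_sup = graded_map_graded_class[OF v s le]
  have "cring (dirlim I (index_rel I \<nu>) (\<lambda>i. graded_ring (\<nu> i)) (\<lambda>i j. graded_map (\<nu> i) (\<nu> j))) \<and>
      dirlim I (index_rel I \<nu>) (\<lambda>i. graded_ring (\<nu> i)) (\<lambda>i j. graded_map (\<nu> i) (\<nu> j))
        \<simeq> graded_ring ?s"
  proof (rule dirlim_cring_and_iso[where \<psi> = "\<lambda>i. graded_map (\<nu> i) ?s"])
    show "cring (graded_ring ?s)" by (rule cring_graded_ring[OF s])
    show "ring (graded_ring (\<nu> i))" if "i \<in> I" for i
      using cring_graded_ring[OF v[OF that]] by (simp add: cring_def)
    show "\<exists>k\<in>I. (i, k) \<in> index_rel I \<nu> \<and> (j, k) \<in> index_rel I \<nu>" if "i \<in> I" "j \<in> I" for i j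
      by (rule directed[OF that])
  next
    fix i j c
    assume ij: "i \<in> I" "j \<in> I" "(i, j) \<in> index_rel I \<nu>" and c: "c \<in> carrier (graded_ring (\<nu> i))"
    obtain a where a: "a \<in> carrier (rees_ring (\<nu> i))" "c = graded_class (\<nu> i) a"
      using graded_class_lift[OF v[OF ij(1)] c] .
    have aj: "a \<in> carrier (rees_ring (\<nu> j))" using a rees_ring_mono[OF rI[OF ij(3)]] by blast
    show "graded_map (\<nu> i) (\<nu> j) c \<in> carrier (graded_ring (\<nu> j))"
      using map[OF ij a(1)] a(2) ring_hom_closed[OF graded_class_hom[OF v[OF ij(2)]] aj] by simp
    show "graded_map (\<nu> j) ?s (graded_map (\<nu> i) (\<nu> j) c) = graded_map (\<nu> i) ?s c"
      using map[OF ij a(1)] map_sup[OF ij(1,1) a(1)] map_sup[OF ij(2,2) aj] a(2) by simp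
  next
    fix i assume i: "i \<in> I"
    note hom_i = graded_class_hom[OF v[OF i]] and hom_s = graded_class_hom[OF s]
    interpret Bi: cring "rees_ring (\<nu> i)" by (rule cring_rees_ring[OF v[OF i]])
    have up: "a \<in> carrier (rees_ring ?s)" if "a \<in> carrier (rees_ring (\<nu> i))" for a
      using that rees_ring_mono[OF le[OF i]] by blast
    show "graded_map (\<nu> i) ?s \<in> ring_hom (graded_ring (\<nu> i)) (graded_ring ?s)"
    proof (rule ring_hom_memI)
      fix c d assume c: "c \<in> carrier (graded_ring (\<nu> i))" and d: "d \<in> carrier (graded_ring (\<nu> i))"
      obtain a where a: "a \<in> carrier (rees_ring (\<nu> i))" "c = graded_class (\<nu> i) a"
        using graded_class_lift[OF v[OF i] c] .
      obtain b where b: "b \<in> carrier (rees_ring (\<nu> i))" "d = graded_class (\<nu> i) b"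
        using graded_class_lift[OF v[OF i] d] .
      note ab = a(1) b(1) and cd = a(2) b(2)
      show "graded_map (\<nu> i) ?s c \<in> carrier (graded_ring ?s)"
        using map_sup[OF i i ab(1)] ring_hom_closed[OF hom_s up[OF ab(1)]] cd by simp
      show "graded_map (\<nu> i) ?s (c \<otimes>\<^bsub>graded_ring (\<nu> i)\<^esub> d) =
          graded_map (\<nu> i) ?s c \<otimes>\<^bsub>graded_ring ?s\<^esub> graded_map (\<nu> i) ?s d"
        using ring_hom_mult[OF hom_i ab, symmetric] ring_hom_mult[OF hom_s up[OF ab(1)] up[OF ab(2)]]
          map_sup[OF i i Bi.m_closed[OF ab]] map_sup[OF i i ab(1)] map_sup[OF i i ab(2)]
        by (simp add: cd)
      show "graded_map (\<nu> i) ?s (c \<oplus>\<^bsub>graded_ring (\<nu> i)\<^esub> d) =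
          graded_map (\<nu> i) ?s c \<oplus>\<^bsub>graded_ring ?s\<^esub> graded_map (\<nu> i) ?s d"
        using ring_hom_add[OF hom_i ab, symmetric] ring_hom_add[OF hom_s up[OF ab(1)] up[OF ab(2)]]
          map_sup[OF i i Bi.a_closed[OF ab]] map_sup[OF i i ab(1)] map_sup[OF i i ab(2)]
        by (simp add: cd)
    next
      show "graded_map (\<nu> i) ?s \<one>\<^bsub>graded_ring (\<nu> i)\<^esub> = \<one>\<^bsub>graded_ring ?s\<^esub>"
        using ring_hom_one[OF hom_i] ring_hom_one[OF hom_s] map_sup[OF i i Bi.one_closed] by simp
    qed
  next
    fix c assume c: "c \<in> carrier (graded_ring ?s)"
    obtain a where a: "a \<in> carrier (rees_ring ?s)" "c = graded_class ?s a"
      using graded_class_lift[OF s c] .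
    obtain i where i: "i \<in> I" "\<forall>f\<in>Poly_Mapping.lookup a ` Poly_Mapping.keys a. stable_index I \<nu> f i"
      using common_stable_index[OF lin ne st, of "Poly_Mapping.lookup a ` Poly_Mapping.keys a"] by auto
    \<comment> \<open>\<open>\<nu> i\<close> agrees with the supremum on the coefficients of \<open>a\<close>, so \<open>a\<close> already defines a class at \<open>i\<close>\<close>
    have ai: "a \<in> carrier (rees_ring (\<nu> i))"
      unfolding mem_rees_ring
    proof
      fix \<gamma>
      show "Poly_Mapping.lookup a \<gamma> \<in> val_ge (\<nu> i) \<gamma>"
      proof (cases "\<gamma> \<in> Poly_Mapping.keys a")
        case True
        then have "?s (Poly_Mapping.lookup a \<gamma>) = \<nu> i (Poly_Mapping.lookup a \<gamma>)"
          using sup_val_eq[OF lin] i(2) by blast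
        moreover have "Poly_Mapping.lookup a \<gamma> \<in> val_ge ?s \<gamma>" using a(1) by (simp add: mem_rees_ring)
        ultimately show ?thesis by (simp add: val_ge_def)
      qed (simp add: in_keys_iff zero_mem_val_ge[OF v[OF i(1)]])
    qed
    then have "graded_class (\<nu> i) a \<in> carrier (graded_ring (\<nu> i))"
      using ring_hom_closed[OF graded_class_hom[OF v[OF i(1)]]] by blast
    then show "\<exists>i\<in>I. \<exists>c'\<in>carrier (graded_ring (\<nu> i)). graded_map (\<nu> i) ?s c' = c"
      using map_sup[OF i(1,1) ai] a(2) i(1) by blast
  next
    fix i j c d
    assume ij: "i \<in> I" "j \<in> I"
      and cd: "c \<in> carrier (graded_ring (\<nu> i))" "d \<in> carrier (graded_ring (\<nu> j))"
      and eq: "graded_map (\<nu> i) ?s c = graded_map (\<nu> j) ?s d"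
    obtain a where a: "a \<in> carrier (rees_ring (\<nu> i))" "c = graded_class (\<nu> i) a"
      using graded_class_lift[OF v[OF ij(1)] cd(1)] .
    obtain b where b: "b \<in> carrier (rees_ring (\<nu> j))" "d = graded_class (\<nu> j) b"
      using graded_class_lift[OF v[OF ij(2)] cd(2)] .
    have as: "a \<in> carrier (rees_ring ?s)" and bs: "b \<in> carrier (rees_ring ?s)"
      using a b rees_ring_mono[OF le] ij by blast+
    have "graded_class ?s a = graded_class ?s b"
      using eq map_sup[OF ij(1,1) a(1)] map_sup[OF ij(2,2) b(1)] a b by simp
    then have gt: "Poly_Mapping.lookup (a - b) \<gamma> \<in> val_gt ?s \<gamma>" for \<gamma>
      by (simp add: graded_class_eq_iff[OF s as bs] lookup_minus)
    \<comment> \<open>choose \<open>k\<close> beyond \<open>i\<close> and \<open>j\<close> with all coefficients of \<open>a - b\<close> stable from \<open>k\<close> on: there the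
      difference already lies in the kernel\<close>
    let ?F = "Poly_Mapping.lookup (a - b) ` Poly_Mapping.keys (a - b)"
    obtain m where m: "m \<in> I" "\<forall>f\<in>?F. stable_index I \<nu> f m"
      using common_stable_index[OF lin ne st, of ?F] by auto
    obtain l where l: "l \<in> I" "(i, l) \<in> index_rel I \<nu>" "(j, l) \<in> index_rel I \<nu>"
      using directed[OF ij] by blast
    obtain k where k: "k \<in> I" "(l, k) \<in> index_rel I \<nu>" "(m, k) \<in> index_rel I \<nu>"
      using directed[OF l(1) m(1)] by blast
    have ik: "(i, k) \<in> index_rel I \<nu>" and jk: "(j, k) \<in> index_rel I \<nu>"
      using trans l k by blast+
    have ak: "a \<in> carrier (rees_ring (\<nu> k))" and bk: "b \<in> carrier (rees_ring (\<nu> k))"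
      using a b rees_ring_mono[OF rI] ik jk by blast+
    have "Poly_Mapping.lookup (a - b) \<gamma> \<in> val_gt (\<nu> k) \<gamma>" for \<gamma>
    proof (cases "\<gamma> \<in> Poly_Mapping.keys (a - b)")
      case True
      then have "stable_index I \<nu> (Poly_Mapping.lookup (a - b) \<gamma>) k"
        using m(2) stable_index_mono[OF _ k(3)] by blast
      then show ?thesis using sup_val_eq[OF lin] gt[of \<gamma>] by (simp add: val_gt_def)
    qed (simp add: in_keys_iff zero_mem_val_gt[OF v[OF k(1)]])
    then have "graded_class (\<nu> k) a = graded_class (\<nu> k) b"
      by (simp add: graded_class_eq_iff[OF v[OF k(1)] ak bk] lookup_minus)
    then show "\<exists>k\<in>I. (i, k) \<in> index_rel I \<nu> \<and> (j, k) \<in> index_rel I \<nu> \<and>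
        graded_map (\<nu> i) (\<nu> k) c = graded_map (\<nu> j) (\<nu> k) d"
      using map[OF ij(1) k(1) ik a(1)] map[OF ij(2) k(1) jk b(1)] a(2) b(2) k(1) ik jk by metis
  qed
  then show ?thesis using cring_graded_ring[OF s] by blast
qed

end
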